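(* The standard monomials in $p(A,B)$, $u(I)$, $\xi(J)$ (with $(A,B)\in H_p$, $I\in H_u$, $J\in H_\xi$) form a basis of the $K$-vector space $S$.
   Context: Let $K$ be an algebraically closed field of arbitrary characteristic, $V=K^n$, $m,q>n$, $X=V^{\oplus m}\oplus(V^* )^{\oplus q}$, with points $(u_1,\dots,u_m,\xi_1,\dots,\xi_q)$, $\langle u_i,\xi_j\rangle=\xi_j(u_i)$. Fixing a basis of $V$, $X$ is identified with $M_{m,n}(K)\times M_{n,q}(K)$, a point being $(U,W)$ with $u_i$ the $i$-th row of $U$ and $\xi_j$ the $j$-th column of $W$. $I(r,k)$ is the set of strictly increasing $r$-tuples of elements of $\{1,\dots,k\}$. For $A\in I(r,k)$, $A'\in I(r',k)$ write $A\ge A'$ if $r\le r'$ and $a_j\ge a'_j$ for $1\le j\le r$. $H_u=I(n,m)$, $H_\xi=I(n,q)$ (regarded as disjoint), $H_p=\bigcup_{1\le r\le n}I(r,m)\times I(r,q)$, $H=H_u\,\dot\cup\,H_\xi\,\dot\cup\,H_p$. Partial order on $H$: on $H_u,H_\xi$ the componentwise order, i.e. $(i_1,\dots,i_n)\ge(i'_1,\dots,i'_n)$ iff $i_j\ge i'_j$ for $1\le j\le n$; on $H_p$, $(A,B)\ge(A',B')$ iff $A\ge A'$ and $B\ge B'$; elements of $H_u$ and $H_\xi$ are never comparable; for $I\in H_u$, $I\le(A,B)$ iff $I\le A$; for $J\in H_\xi$, $J\le(A,B)$ iff $J\le B$; no element of $H_u$ or $H_\xi$ is greater than an element of $H_p$.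 Functions on $X$: $p(A,B)=\det(\langle u_i,\xi_j\rangle)_{i\in A,j\in B}$ for $(A,B)\in H_p$; $u(I)$, $I\in H_u$, is the $n$-minor of $U$ with rows $I$; $\xi(J)$, $J\in H_\xi$, is the $n$-minor of $W$ with columns $J$. $S$ is the $K$-subalgebra of $K[X]$ generated by all $p(A,B),u(I),\xi(J)$. Standard monomials: monomials $p(A_1,B_1)\cdots p(A_r,B_r)u(I_1)\cdots u(I_s)$ with $(A_1,B_1)\ge\cdots\ge(A_r,B_r)\ge I_1\ge\cdots\ge I_s$ in $H$, or $p(A_1,B_1)\cdots p(A_r,B_r)\xi(J_1)\cdots\xi(J_t)$ with $(A_1,B_1)\ge\cdots\ge(A_r,B_r)\ge J_1\ge\cdots\ge J_t$ in $H$ ($r,s,t\ge0$). *)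

theory Defs
  imports
    "HOL-Library.Function_Algebras"
    "Jordan_Normal_Form.Determinant"
begin

text \<open>
  Row and column indices start at 0, as usual for \<open>'a mat\<close>: the set \<open>{1, \<dots>, k}\<close> becomes
  \<open>{..<k}\<close>. The shift changes neither the orders nor the minors.

  A point of \<open>X\<close> is a pair \<open>(U, W)\<close>, with \<open>u\<^sub>i = row U i\<close> and \<open>\<xi>\<^sub>j = col W j\<close>. Over the infinite
  field \<open>K\<close>, the ring \<open>K[X]\<close> is the ring of polynomial functions on \<open>X\<close>. A function
  on \<open>X\<close> is represented by its extension by 0 to the whole type, so that equality of representatives
  is equality on \<open>X\<close>.
\<close>

definition X_space :: "nat \<Rightarrow> nat \<Rightarrow> nat \<Rightarrow> ('k mat \<times> 'k mat) set" where
  "X_space n m q = carrier_mat m n \<times> carrier_mat n q"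

definition fun_on :: "'x set \<Rightarrow> ('x \<Rightarrow> 'k::field) \<Rightarrow> 'x \<Rightarrow> 'k" where
  "fun_on X f = (\<lambda>x. if x \<in> X then f x else 0)"

definition fscale :: "'k::field \<Rightarrow> ('x \<Rightarrow> 'k) \<Rightarrow> 'x \<Rightarrow> 'k" where
  "fscale c f = (\<lambda>x. c * f x)"

global_interpretation fun_vs: vector_space "fscale :: 'k::field \<Rightarrow> ('x \<Rightarrow> 'k) \<Rightarrow> 'x \<Rightarrow> 'k"
  by unfold_locales (auto simp: fscale_def fun_eq_iff algebra_simps)

text \<open>The unit of the algebra of functions on \<open>X\<close> is \<open>fun_on X (\<lambda>_. 1)\<close>, not the constant 1.\<close>

definition subalgebra :: "'x set \<Rightarrow> ('x \<Rightarrow> 'k::field) set \<Rightarrow> bool" where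
  "subalgebra X A \<longleftrightarrow>
     (\<forall>f\<in>A. fun_on X f = f) \<and> fun_vs.subspace A \<and>
     fun_on X (\<lambda>_. 1) \<in> A \<and> (\<forall>f\<in>A. \<forall>g\<in>A. f * g \<in> A)"

definition coord_ring :: "nat \<Rightarrow> nat \<Rightarrow> nat \<Rightarrow> ('k mat \<times> 'k mat \<Rightarrow> 'k::field) set" where
  "coord_ring n m q = subalgebra (X_space n m q) hull
     ({fun_on (X_space n m q) (\<lambda>(U, W). U $$ (i, k)) | i k. i < m \<and> k < n} \<union>
      {fun_on (X_space n m q) (\<lambda>(U, W). W $$ (k, j)) | k j. k < n \<and> j < q})"

definition idx :: "nat \<Rightarrow> nat \<Rightarrow> nat list set" where
  "idx r k = {A. length A = r \<and> sorted_wrt (<) A \<and> set A \<subseteq> {..<k}}"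

definition idx_ge :: "nat list \<Rightarrow> nat list \<Rightarrow> bool" where
  "idx_ge A A' \<longleftrightarrow> length A \<le> length A' \<and> (\<forall>j<length A. A ! j \<ge> A' ! j)"

datatype hindex = HP "nat list" "nat list" | HU "nat list" | HXi "nat list"

definition H_set :: "nat \<Rightarrow> nat \<Rightarrow> nat \<Rightarrow> hindex set" where
  "H_set n m q = HU ` idx n m \<union> HXi ` idx n q \<union>
     (\<Union>r\<in>{1..n}. {HP A B | A B. A \<in> idx r m \<and> B \<in> idx r q})"

fun H_ge :: "hindex \<Rightarrow> hindex \<Rightarrow> bool" where
  "H_ge (HP A B) (HP A' B') \<longleftrightarrow> idx_ge A A' \<and> idx_ge B B'"
| "H_ge (HP A B) (HU I) \<longleftrightarrow> idx_ge A I"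
| "H_ge (HP A B) (HXi J) \<longleftrightarrow> idx_ge B J"
| "H_ge (HU I) (HU I') \<longleftrightarrow> idx_ge I I'"
| "H_ge (HXi J) (HXi J') \<longleftrightarrow> idx_ge J J'"
| "H_ge _ _ \<longleftrightarrow> False"

fun H_val :: "nat \<Rightarrow> hindex \<Rightarrow> 'k mat \<times> 'k mat \<Rightarrow> 'k::field" where
  "H_val n (HP A B) (U, W) =
     det (mat (length A) (length B) (\<lambda>(i, j). row U (A ! i) \<bullet> col W (B ! j)))"
| "H_val n (HU I) (U, W) = det (mat n n (\<lambda>(i, k). U $$ (I ! i, k)))"
| "H_val n (HXi J) (U, W) = det (mat n n (\<lambda>(k, j). W $$ (k, J ! j)))"

definition H_fun :: "nat \<Rightarrow> nat \<Rightarrow> nat \<Rightarrow> hindex \<Rightarrow> 'k mat \<times> 'k mat \<Rightarrow> 'k::field" where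
  "H_fun n m q h = fun_on (X_space n m q) (H_val n h)"

definition S_alg :: "nat \<Rightarrow> nat \<Rightarrow> nat \<Rightarrow> ('k mat \<times> 'k mat \<Rightarrow> 'k::field) set" where
  "S_alg n m q = subalgebra (X_space n m q) hull (H_fun n m q ` H_set n m q)"

text \<open>
  A standard monomial is indexed by its decreasing sequence of factors. A monomial has at most
  one such arrangement, and the monomials with \<open>s = 0\<close> or \<open>t = 0\<close> common to the two families
  are counted once.
\<close>

definition standard_seqs :: "nat \<Rightarrow> nat \<Rightarrow> nat \<Rightarrow> hindex list set" where
  "standard_seqs n m q = {hs. set hs \<subseteq> H_set n m q \<and> sorted_wrt H_ge hs \<and>
     (\<exists>ps. (\<exists>Is. hs = map (case_prod HP) ps @ map HU Is) \<or>
           (\<exists>Js. hs = map (case_prod HP) ps @ map HXi Js))}"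

definition monomial_fun :: "nat \<Rightarrow> nat \<Rightarrow> nat \<Rightarrow> hindex list \<Rightarrow> 'k mat \<times> 'k mat \<Rightarrow> 'k::field" where
  "monomial_fun n m q hs = fun_on (X_space n m q) (\<lambda>x. \<Prod>h\<leftarrow>hs. H_fun n m q h x)"

text \<open>A family is a basis of a subspace if it has no repetitions and its range is a basis.\<close>

definition family_basis :: "'i set \<Rightarrow> ('i \<Rightarrow> 'x \<Rightarrow> 'k::field) \<Rightarrow> ('x \<Rightarrow> 'k) set \<Rightarrow> bool" where
  "family_basis I b V \<longleftrightarrow>
     inj_on b I \<and> \<not> fun_vs.dependent (b ` I) \<and> fun_vs.span (b ` I) = V"


subsection \<open>The generators of \<open>S\<close> are regular functions on \<open>X\<close>\<close>

lemma subalgebra_hull: 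
  assumes "\<And>f. f \<in> G \<Longrightarrow> fun_on X f = f"
  shows "subalgebra X (subalgebra X hull G)"
proof -
  have "subalgebra X {f. fun_on X f = f}"
    unfolding subalgebra_def fun_vs.subspace_def
    by (auto simp: fun_on_def fscale_def fun_eq_iff)
  then have "{f. fun_on X f = f} \<in> {T. subalgebra X T \<and> G \<subseteq> T}"
    using assms by blast
  then show ?thesis
    unfolding hull_def subalgebra_def fun_vs.subspace_def by blast
qed

lemma coord_ring_subalgebra: "subalgebra (X_space n m q) (coord_ring n m q)"
  unfolding coord_ring_def by (rule subalgebra_hull) (auto simp: fun_on_def fun_eq_iff)

context
  fixes X :: "'x set" and R :: "('x \<Rightarrow> 'k::field) set"
  assumes R: "subalgebra X R"
begin

lemma subalgebra_const: "fun_on X (\<lambda>_. c) \<in> R"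
proof -
  have "fun_on X (\<lambda>_. c) = fscale c (fun_on X (\<lambda>_. 1))"
    by (auto simp: fun_on_def fscale_def fun_eq_iff)
  then show ?thesis
    using R by (auto simp: subalgebra_def fun_vs.subspace_def)
qed

lemma subalgebra_sum:
  assumes "\<And>i. i \<in> I \<Longrightarrow> fun_on X (f i) \<in> R"
  shows "fun_on X (\<lambda>x. \<Sum>i\<in>I. f i x) \<in> R"
  using assms
proof (induction I rule: infinite_finite_induct)
  case (insert i I)
  have "fun_on X (\<lambda>x. \<Sum>i\<in>insert i I. f i x) = fun_on X (f i) + fun_on X (\<lambda>x. \<Sum>i\<in>I. f i x)"
    using insert.hyps by (auto simp: fun_on_def fun_eq_iff)
  moreover have "\<dots> \<in> R"
    using R insert.IH insert.prems unfolding subalgebra_def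
    by (intro fun_vs.subspace_add) blast+
  ultimately show ?case
    by (simp only:)
qed (auto intro: subalgebra_const)

lemma subalgebra_mult:
  assumes "fun_on X f \<in> R" "fun_on X g \<in> R"
  shows "fun_on X (\<lambda>x. f x * g x) \<in> R"
proof -
  have "fun_on X (\<lambda>x. f x * g x) = fun_on X f * fun_on X g"
    by (auto simp: fun_on_def fun_eq_iff)
  then show ?thesis
    using R assms by (auto simp: subalgebra_def)
qed

lemma subalgebra_prod:
  assumes "\<And>i. i \<in> I \<Longrightarrow> fun_on X (f i) \<in> R"
  shows "fun_on X (\<lambda>x. \<Prod>i\<in>I. f i x) \<in> R"
  using assms
proof (induction I rule: infinite_finite_induct)
  case (insert i I)
  then show ?case
    using subalgebra_mult[of "f i"] by simp
qed (auto intro: subalgebra_const)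

lemma subalgebra_det:
  assumes "\<And>i j. i < r \<Longrightarrow> j < r \<Longrightarrow> fun_on X (\<lambda>x. a x i j) \<in> R"
  shows "fun_on X (\<lambda>x. det (mat r r (\<lambda>(i, j). a x i j))) \<in> R"
proof -
  have less: "p i < r" if "p permutes {0..<r}" "i < r" for p i
    using permutes_in_image[OF that(1), of i] that(2) by simp
  have "det (mat r r (\<lambda>(i, j). a x i j)) =
     (\<Sum>p | p permutes {0..<r}. signof p * (\<Prod>i = 0..<r. a x i (p i)))" for x
    unfolding det_def by (auto intro!: sum.cong prod.cong simp: less)
  then show ?thesis
    using assms
    by (auto intro!: subalgebra_sum subalgebra_mult subalgebra_prod subalgebra_const
        simp: less)
qed

end

lemma H_fun_coord_ring:
  assumes "h \<in> H_set n m q"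
  shows "(H_fun n m q h :: 'k mat \<times> 'k mat \<Rightarrow> 'k::field) \<in> coord_ring n m q"
proof -
  let ?X = "X_space n m q :: ('k mat \<times> 'k mat) set"
  let ?R = "coord_ring n m q :: ('k mat \<times> 'k mat \<Rightarrow> 'k) set"
  note R = coord_ring_subalgebra[of n m q, where 'a = 'k]
  have U: "fun_on ?X (\<lambda>x. fst x $$ (i, k)) \<in> ?R" if "i < m" "k < n" for i k
    unfolding coord_ring_def
    by (rule subsetD[OF hull_subset]) (use that in \<open>auto simp: case_prod_unfold\<close>)
  have W: "fun_on ?X (\<lambda>x. snd x $$ (k, j)) \<in> ?R" if "j < q" "k < n" for k j
    unfolding coord_ring_def
    by (rule subsetD[OF hull_subset]) (use that in \<open>auto simp: case_prod_unfold\<close>)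
  have pair: "fun_on ?X (\<lambda>x. row (fst x) i \<bullet> col (snd x) j) \<in> ?R" if "i < m" "j < q" for i j
  proof -
    have "fun_on ?X (\<lambda>x. row (fst x) i \<bullet> col (snd x) j) =
      fun_on ?X (\<lambda>x. \<Sum>k\<in>{0..<n}. fst x $$ (i, k) * snd x $$ (k, j))"
      using that by (auto simp: fun_on_def fun_eq_iff X_space_def scalar_prod_def)
    then show ?thesis
      using that by (auto intro!: subalgebra_sum[OF R] subalgebra_mult[OF R] U W)
  qed
  show ?thesis
  proof (cases h)
    case (HP A B)
    then have "length B = length A" "set A \<subseteq> {..<m}" "set B \<subseteq> {..<q}"
      using assms by (auto simp: H_set_def idx_def)
    moreover have "H_val n h = (\<lambda>x. det (mat (length A) (length B)
        (\<lambda>(i, j). row (fst x) (A ! i) \<bullet> col (snd x) (B ! j))) :: 'k)"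
      by (auto simp: HP fun_eq_iff)
    moreover have "A ! i < m" if "set A \<subseteq> {..<m}" "i < length A" for i
      using that nth_mem by blast
    moreover have "B ! i < q" if "set B \<subseteq> {..<q}" "i < length B" for i
      using that nth_mem by blast
    ultimately show ?thesis
      unfolding H_fun_def by (auto intro!: subalgebra_det[OF R] pair)
  next
    case (HU I)
    then have I: "length I = n" "set I \<subseteq> {..<m}"
      using assms by (auto simp: H_set_def idx_def)
    have "H_val n h = (\<lambda>x. det (mat n n (\<lambda>(i, k). fst x $$ (I ! i, k))) :: 'k)"
      by (auto simp: HU fun_eq_iff)
    moreover have "I ! i < m" if "i < n" for i
      using I that nth_mem by blast
    ultimately show ?thesis
      unfolding H_fun_def by (auto intro!: subalgebra_det[OF R] U)
  next
    case (HXi J)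
    then have J: "length J = n" "set J \<subseteq> {..<q}"
      using assms by (auto simp: H_set_def idx_def)
    have "H_val n h = (\<lambda>x. det (mat n n (\<lambda>(k, j). snd x $$ (k, J ! j))) :: 'k)"
      by (auto simp: HXi fun_eq_iff)
    moreover have "J ! i < q" if "i < n" for i
      using J that nth_mem by blast
    ultimately show ?thesis
      unfolding H_fun_def by (auto intro!: subalgebra_det[OF R] W)
  qed
qed

lemma S_alg_subset_coord_ring: "S_alg n m q \<subseteq> coord_ring n m q"
  unfolding S_alg_def
  by (rule hull_minimal) (auto intro: H_fun_coord_ring coord_ring_subalgebra)

lemma S_alg_subalgebra: "subalgebra (X_space n m q) (S_alg n m q)"
  unfolding S_alg_def
  by (rule subalgebra_hull) (auto simp: H_fun_def fun_on_def fun_eq_iff)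

end

theory Submission
  imports Defs
begin

text \<open>
  That the standard monomials span follows by straightening. The generators are minors
  of pairings between vectors and covectors: \<open>p(A, B)\<close> pairs the \<open>u\<^sub>i\<close> with the
  \<open>\<xi>\<^sub>j\<close>, and \<open>u(I)\<close> pairs \<open>n\<close> of the \<open>u\<^sub>i\<close> with the coordinate covectors. Suppose that two factors \<open>(A|B)\<close>, \<open>(C|D)\<close> with \<open>|A| \<le> |C|\<close> violate the order at
  position \<open>j\<close>, so that \<open>a\<^sub>j < c\<^sub>j\<close>. Then \<open>a\<^sub>1 < \<dots> < a\<^sub>j < c\<^sub>j < \<dots> < c\<^sub>l\<close> are \<open>l + 1\<close> rows. Consider
  the square matrix with rows \<open>A, C\<close> and columns \<open>B, D\<close> in which these rows are kept in full and
  every other row is set to zero in the columns of the opposite factor. Laplace expansion along the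
  columns \<open>B\<close> gives \<open>\<plusminus>(A|B)(C|D)\<close> plus terms \<open>\<plusminus>(A'|B)(C'|D)\<close>, where the shuffle has moved larger
  labels into the first factor. Laplace expansion along the \<open>l + 1\<close> full rows gives products that
  contain a minor of size \<open>l + 1\<close>. Comparing the two expansions rewrites \<open>(A|B)(C|D)\<close>. Every
  coefficient is a sign, so the argument does not depend on the characteristic
  (\<open>garnir_exchange\<close>). Minors of size \<open>n + 1\<close> vanish, because the pairing has rank at most \<open>n\<close>; so
  an exchange with a maximal minor produces no larger minors at all, and the factors \<open>u(I)\<close>
  survive unchanged in number. Shapes can only grow finitely often, and within a fixed shape the
  larger labels only move towards the front; hence the rewriting terminates (\<open>straightening\<close>).
  Violations on the \<open>B\<close> side are treated by transposing the pairing, the factors \<open>\<xi>(J)\<close> by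
  exchanging the roles of \<open>U\<close> and \<open>W\<close>, and a product \<open>u(I) \<xi>(J)\<close> is \<open>p(I, J)\<close>, so that only
  one of the two kinds of maximal minors remains.

  That they are independent is seen from leading terms. Substitute for each coordinate a power of one variable \<open>t\<close>, with exponents that
  grow so fast that comparing degrees means comparing monomials lexicographically. The
  coordinates are ordered so that the leading term of \<open>p(A, B)\<close> is
  \<open>\<Prod>\<^sub>j U(a\<^sub>j, j) W(j, b\<^sub>j)\<close>, and that of \<open>u(I)\<close> or \<open>\<xi>(J)\<close> is the product along the diagonal. The
  leading term of a standard monomial therefore records the content of each column of its two
  tableaux. The columns of a standard tableau are sorted, so these contents determine the tableau,
  and the two tableaux determine the monomial. Distinct standard monomials thus become
  polynomials in \<open>t\<close> of distinct degrees (\<open>monic_deg_monomial\<close>, \<open>seq_cells_inj\<close>), and a vanishing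
  linear combination of them, having infinitely many roots, is trivial.
\<close>

section \<open>Minors of a pairing\<close>

text \<open>
  Rows and columns are lists of labels rather than indices: shuffling, sorting and selecting
  labels then act on the lists, and the pairing stays fixed.
\<close>

definition bracket :: "('a \<Rightarrow> 'b \<Rightarrow> 'k::comm_ring_1) \<Rightarrow> 'a list \<Rightarrow> 'b list \<Rightarrow> 'k" where
  "bracket g A B = det (mat (length A) (length A) (\<lambda>(i, j). g (A ! i) (B ! j)))"

lemma bracket_cong:
  assumes "\<And>a b. a \<in> set A \<Longrightarrow> b \<in> set B \<Longrightarrow> g a b = g' a b" "length B = length A"
  shows "bracket g A B = bracket g' A B"
  unfolding bracket_def using assms by (intro arg_cong[where f = det] eq_matI) auto

lemma bracket_Nil [simp]: "bracket g [] B = 1"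
  by (simp add: bracket_def)

lemma bracket_leibniz:
  assumes "length B = length A"
  shows "bracket g A B = (\<Sum>p | p permutes {0..<length A}. signof p * (\<Prod>i = 0..<length A. g (A ! i) (B ! p i)))"
proof -
  have lt: "p i < length A" if "p permutes {0..<length A}" "i < length A" for p i
    using permutes_in_image[OF that(1), of i] that(2) by simp
  show ?thesis
    unfolding bracket_def det_def by (auto intro!: sum.cong prod.cong simp: lt)
qed

lemma bracket_map:
  assumes "length B = length A"
  shows "bracket g (map r A) (map c B) = bracket (\<lambda>i j. g (r i) (c j)) A B"
  unfolding bracket_def using assms by (intro arg_cong[where f = det] eq_matI) auto

lemma bracket_transpose:
  assumes "length B = length A"
  shows "bracket g A B = bracket (\<lambda>b a. g a b) B A"
proof -
  have "mat (length B) (length B) (\<lambda>(i, j). g (A ! j) (B ! i))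
      = transpose_mat (mat (length A) (length A) (\<lambda>(i, j). g (A ! i) (B ! j)))"
    using assms by (intro eq_matI) auto
  then show ?thesis
    unfolding bracket_def by (simp add: det_transpose[of _ "length A"])
qed

text \<open>
  The sign depends only on the two lists, not on the pairing. A linear relation between minors
  that is proved with such signs holds with constant coefficients as the pairing varies over \<open>X\<close>.
\<close>

lemma bracket_perm_rows:
  assumes "mset A' = mset A"
  shows "\<exists>\<epsilon>\<in>{1, -1}. \<forall>g B. length B = length A \<longrightarrow> bracket g A' B = \<epsilon> * (bracket g A B :: 'k::comm_ring_1)"
proof -
  obtain p where p: "p permutes {..<length A}" "permute_list p A = A'"
    using mset_eq_permutation[OF assms] .
  have p0: "p permutes {0..<length A}" using p(1) by (simp add: atLeast0LessThan)
  have len: "length A' = length A" using assms by (rule mset_eq_length)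
  have "bracket g A' B = signof p * bracket g A B" if "length B = length A" for g and B :: "'b list"
  proof -
    let ?M = "mat (length A) (length A) (\<lambda>(i, j). g (A ! i) (B ! j))"
    have lt: "p i < length A" if "i < length A" for i
      using permutes_in_image[OF p(1), of i] that by simp
    have "bracket g A' B = det (mat (length A) (length A) (\<lambda>(i, j). ?M $$ (p i, j)))"
      unfolding bracket_def len
      by (intro arg_cong[where f = det] eq_matI)
        (auto simp: lt p(2)[symmetric] permute_list_nth[OF p(1)])
    also have "\<dots> = signof p * bracket g A B"
      unfolding bracket_def by (rule det_permute_rows[OF _ p0]) simp
    finally show ?thesis .
  qed
  then show ?thesis
    by (intro bexI[of _ "signof p"]) (auto simp: sign_def)
qed

lemma bracket_perm_cols:
  assumes "mset B' = mset B"
  shows "\<exists>\<epsilon>\<in>{1, -1}. \<forall>g A. length B = length A \<longrightarrow> bracket g A B' = \<epsilon> * (bracket g A B :: 'k::comm_ring_1)"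
proof -
  obtain \<epsilon> :: 'k where e: "\<epsilon> \<in> {1, -1}"
    "\<And>g (A :: 'b list). length A = length B \<Longrightarrow> bracket g B' A = \<epsilon> * bracket g B A"
    using bracket_perm_rows[OF assms] by metis
  have "length B' = length B" using assms by (rule mset_eq_length)
  then show ?thesis
    using e(1) by (intro bexI[of _ \<epsilon>]) (auto simp: bracket_transpose[of B'] bracket_transpose[of B] e(2))
qed

lemma bracket_not_distinct_rows:
  assumes "\<not> distinct A" "length B = length A"
  shows "bracket g A B = 0"
proof -
  obtain i j where "i < length A" "j < length A" "i \<noteq> j" "A ! i = A ! j"
    using assms(1) by (auto simp: distinct_conv_nth)
  then show ?thesis
    unfolding bracket_def by (intro det_identical_rows[of _ "length A" i j]) auto
qed

lemma bracket_not_distinct_cols: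
  assumes "\<not> distinct B" "length B = length A"
  shows "bracket g A B = 0"
  using bracket_not_distinct_rows[of B A] assms by (simp add: bracket_transpose[of B])

lemma bracket_zero_row:
  assumes "a \<in> set A" "\<And>b. b \<in> set B \<Longrightarrow> g a b = 0" "length B = length A"
  shows "bracket g A B = 0"
proof -
  obtain i where i: "i < length A" "A ! i = a" using assms(1) by (auto simp: in_set_conv_nth)
  have "(\<Prod>k = 0..<length A. g (A ! k) (B ! p k)) = 0" if "p permutes {0..<length A}" for p
    using i assms permutes_in_image[OF that, of i] by (intro prod_zero bexI[of _ i]) auto
  then show ?thesis
    unfolding bracket_leibniz[OF assms(3)] by (intro sum.neutral) auto
qed

text \<open>
  Multilinearity in the rows. Summing over \<open>k < n\<close> in a matrix product gives the Cauchy-Binet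
  expansion; summing over two colours gives Laplace expansion.
\<close>

lemma bracket_sum_rows:
  fixes g :: "'c \<Rightarrow> 'a \<Rightarrow> 'b \<Rightarrow> 'k::comm_ring_1"
  assumes "finite S" "length B = length A"
  shows "bracket (\<lambda>a b. \<Sum>c\<in>S. g c a b) A B =
    (\<Sum>f\<in>{0..<length A} \<rightarrow>\<^sub>E S. det (mat (length A) (length A) (\<lambda>(i, j). g (f i) (A ! i) (B ! j))))"
proof -
  let ?l = "length A"
  let ?P = "{p. p permutes {0..<?l}}"
  have lt: "p i < ?l" if "p permutes {0..<?l}" "i < ?l" for p i
    using permutes_in_image[OF that(1), of i] that(2) by simp
  have "bracket (\<lambda>a b. \<Sum>c\<in>S. g c a b) A B =
    (\<Sum>p\<in>?P. signof p * (\<Prod>i = 0..<?l. \<Sum>c\<in>S. g c (A ! i) (B ! p i)))"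
    by (rule bracket_leibniz[OF assms(2)])
  also have "\<dots> = (\<Sum>p\<in>?P. \<Sum>f\<in>{0..<?l} \<rightarrow>\<^sub>E S. signof p * (\<Prod>i = 0..<?l. g (f i) (A ! i) (B ! p i)))"
    using assms by (subst prod_sum_PiE) (auto simp: sum_distrib_left)
  also have "\<dots> = (\<Sum>f\<in>{0..<?l} \<rightarrow>\<^sub>E S. \<Sum>p\<in>?P. signof p * (\<Prod>i = 0..<?l. g (f i) (A ! i) (B ! p i)))"
    by (rule sum.swap)
  also have "\<dots> = (\<Sum>f\<in>{0..<?l} \<rightarrow>\<^sub>E S. det (mat ?l ?l (\<lambda>(i, j). g (f i) (A ! i) (B ! j))))"
    unfolding det_def by (auto intro!: sum.cong prod.cong simp: lt)
  finally show ?thesis .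
qed

text \<open>
  Two rows of such a matrix are proportional to the same vector \<open>w (f i)\<close>.
\<close>

lemma bracket_rank_term:
  assumes f: "\<not> inj_on f {0..<l}" and len: "length A = l" "length B = l"
  shows "det (mat l l (\<lambda>(i, j). u (A ! i) (f i) * w (f i) (B ! j) :: 'k::comm_ring_1)) = 0"
proof -
  obtain i i' where i: "i < l" "i' < l" "i \<noteq> i'" "f i = f i'"
    using f by (auto simp: inj_on_def)
  have "mat l l (\<lambda>(i, j). u (A ! i) (f i) * w (f i) (B ! j)) =
    mat\<^sub>r l l (\<lambda>i. u (A ! i) (f i) \<cdot>\<^sub>v vec l (\<lambda>j. w (f i) (B ! j)))"
    by (rule eq_matI) auto
  also have "det \<dots> = (\<Prod>i = 0..<l. u (A ! i) (f i)) * det (mat\<^sub>r l l (\<lambda>i. vec l (\<lambda>j. w (f i) (B ! j))))"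
    by (rule det_rows_mul) auto
  also have "det (mat\<^sub>r l l (\<lambda>i. vec l (\<lambda>j. w (f i) (B ! j)))) = 0"
    using i by (intro det_identical_rows[of _ l i i']) (auto simp: mat_of_row_def row_mat_of_row_fun)
  finally show ?thesis by simp
qed

lemma bracket_rank:
  assumes "n < length A" "length B = length A"
  shows "bracket (\<lambda>a b. \<Sum>k<n. u a k * w k b) A B = 0"
proof -
  let ?l = "length A"
  have "det (mat ?l ?l (\<lambda>(i, j). u (A ! i) (f i) * w (f i) (B ! j))) = 0"
    if f: "f \<in> {0..<?l} \<rightarrow>\<^sub>E {..<n}" for f
  proof (rule bracket_rank_term[OF _ refl assms(2)])
    show "\<not> inj_on f {0..<?l}"
      using f assms(1) card_inj_on_le[of f "{0..<?l}" "{..<n}"] by auto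
  qed
  then show ?thesis
    using bracket_sum_rows[of "{..<n}" B A "\<lambda>k a b. u a k * w k b"] assms by simp
qed

lemma bracket_block_append:
  fixes g :: "'a \<Rightarrow> 'b \<Rightarrow> 'k::idom"
  assumes "length B = length A" "length D = length C"
    "\<And>a d. a \<in> set A \<Longrightarrow> d \<in> set D \<Longrightarrow> g a d = 0"
  shows "bracket g (A @ C) (B @ D) = bracket g A B * bracket g C D"
proof -
  let ?r = "length A" and ?l = "length C"
  have "mat (?r + ?l) (?r + ?l) (\<lambda>(i, j). g ((A @ C) ! i) ((B @ D) ! j)) =
    four_block_mat (mat ?r ?r (\<lambda>(i, j). g (A ! i) (B ! j))) (0\<^sub>m ?r ?l)
      (mat ?l ?r (\<lambda>(i, j). g (C ! i) (B ! j))) (mat ?l ?l (\<lambda>(i, j). g (C ! i) (D ! j)))"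
    using assms by (intro eq_matI) (auto simp: nth_append)
  then show ?thesis
    unfolding bracket_def by (simp add: det_four_block_mat_upper_right_zero[of _ ?r _ ?l])
qed

text \<open>
  Rows coloured by \<open>P\<close> and columns coloured by \<open>Q\<close>: if all entries of mixed colour vanish, sorting
  by colour makes the matrix block diagonal. If the colour classes have different sizes, every
  term of the Leibniz formula meets an entry of mixed colour.
\<close>

lemma bracket_block_filter:
  fixes P :: "'a \<Rightarrow> bool" and Q :: "'b \<Rightarrow> bool"
  assumes "length B = length A"
  shows "\<exists>\<epsilon>::'k::idom. (length (filter P A) = length (filter Q B) \<longrightarrow> \<epsilon> \<in> {1, -1}) \<and>
    (length (filter P A) \<noteq> length (filter Q B) \<longrightarrow> \<epsilon> = 0) \<and>
    (\<forall>g. bracket (\<lambda>a b. if P a = Q b then g a b else 0) A B =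
      \<epsilon> * bracket g (filter P A) (filter Q B) *
        bracket g (filter (\<lambda>a. \<not> P a) A) (filter (\<lambda>b. \<not> Q b) B))"
proof (cases "length (filter P A) = length (filter Q B)")
  case True
  have len: "length (filter (\<lambda>a. \<not> P a) A) = length (filter (\<lambda>b. \<not> Q b) B)"
    using True assms sum_length_filter_compl[of P A] sum_length_filter_compl[of Q B] by simp
  let ?A = "filter P A @ filter (\<lambda>a. \<not> P a) A"
  let ?B = "filter Q B @ filter (\<lambda>b. \<not> Q b) B"
  have mA: "mset A = mset ?A" and mB: "mset B = mset ?B"
    by (metis mset_append mset_filter multiset_partition)+
  have lA: "length ?A = length A" "length ?B = length A"
    using mset_eq_length[OF mA] mset_eq_length[OF mB] assms by auto
  obtain e1 :: 'k where e1: "e1 \<in> {1, -1}"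
    "\<And>g (B :: 'b list). length B = length ?A \<Longrightarrow> bracket g A B = e1 * bracket g ?A B"
    using bracket_perm_rows[OF mA] by metis
  obtain e2 :: 'k where e2: "e2 \<in> {1, -1}"
    "\<And>g (A :: 'a list). length ?B = length A \<Longrightarrow> bracket g A B = e2 * bracket g A ?B"
    using bracket_perm_cols[OF mB] by metis
  have "bracket (\<lambda>a b. if P a = Q b then g a b else 0) A B =
      e1 * e2 * bracket g (filter P A) (filter Q B) *
        bracket g (filter (\<lambda>a. \<not> P a) A) (filter (\<lambda>b. \<not> Q b) B)" for g
  proof -
    let ?h = "\<lambda>a b. if P a = Q b then g a b else 0"
    have "bracket ?h A B = e1 * (e2 * bracket ?h ?A ?B)"
      unfolding e1(2)[of B ?h, unfolded lA, OF assms] e2(2)[of ?A ?h, unfolded lA, OF refl] ..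
    also have "bracket ?h ?A ?B = bracket ?h (filter P A) (filter Q B) *
        bracket ?h (filter (\<lambda>a. \<not> P a) A) (filter (\<lambda>b. \<not> Q b) B)"
      using True len by (intro bracket_block_append) auto
    also have "bracket ?h (filter P A) (filter Q B) = bracket g (filter P A) (filter Q B)"
      using True by (intro bracket_cong) auto
    also have "bracket ?h (filter (\<lambda>a. \<not> P a) A) (filter (\<lambda>b. \<not> Q b) B) =
        bracket g (filter (\<lambda>a. \<not> P a) A) (filter (\<lambda>b. \<not> Q b) B)"
      using len by (intro bracket_cong) auto
    finally show ?thesis by (simp add: mult.assoc)
  qed
  then show ?thesis using True e1(1) e2(1) by (intro exI[of _ "e1 * e2"]) auto
next
  case False
  have "bracket (\<lambda>a b. if P a = Q b then g a b else 0) A B = 0" for g :: "'a \<Rightarrow> 'b \<Rightarrow> 'k"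
  proof -
    let ?l = "length A"
    have "(\<Prod>i = 0..<?l. if P (A ! i) = Q (B ! p i) then g (A ! i) (B ! p i) else 0) = 0"
      if p: "p permutes {0..<?l}" for p
    proof -
      have lt: "p i < ?l" if "i < ?l" for i using permutes_in_image[OF p, of i] that by simp
      \<comment> \<open>Otherwise \<open>p\<close> would restrict to a bijection between the coloured rows and the coloured columns.\<close>
      have "\<exists>i<?l. P (A ! i) \<noteq> Q (B ! p i)"
      proof (rule ccontr)
        assume "\<not> ?thesis"
        then have *: "P (A ! i) = Q (B ! p i)" if "i < ?l" for i using that by blast
        have "p ` {i. i < ?l \<and> P (A ! i)} = {j. j < ?l \<and> Q (B ! j)}"
        proof (intro equalityI subsetI)
          fix j assume j: "j \<in> {j. j < ?l \<and> Q (B ! j)}"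
          then have "j \<in> p ` {0..<?l}" using permutes_image[OF p] by simp
          then obtain i where "i < ?l" "j = p i" by auto
          then show "j \<in> p ` {i. i < ?l \<and> P (A ! i)}" using j * by auto
        qed (use * lt in auto)
        then have "card {i. i < ?l \<and> P (A ! i)} = card {j. j < ?l \<and> Q (B ! j)}"
          using card_image[OF inj_on_subset[OF permutes_inj[OF p] subset_UNIV], of "{i. i < ?l \<and> P (A ! i)}"] by simp
        then show False using False assms by (simp add: length_filter_conv_card)
      qed
      then show ?thesis by (intro prod_zero) auto
    qed
    then show ?thesis
      unfolding bracket_leibniz[OF assms] by (intro sum.neutral) auto
  qed
  then show ?thesis using False by (intro exI[of _ 0]) auto
qed

text \<open>
  Laplace expansion along the columns coloured by \<open>Q\<close>. Each row is the sum of its parts in the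
  two colour classes of columns; multilinearity lets \<open>f\<close> choose one part for each row, and the
  resulting matrices have block form. Row labels are positions, because a colouring \<open>f\<close> must be
  able to separate two rows with equal labels.
\<close>

lemma bracket_laplace_rows:
  fixes Q :: "'b \<Rightarrow> bool"
  assumes "length B = k"
  shows "\<exists>\<epsilon> :: (nat \<Rightarrow> bool) \<Rightarrow> 'k::idom.
    (\<forall>f. length (filter f [0..<k]) = length (filter Q B) \<longrightarrow> \<epsilon> f \<in> {1, -1}) \<and>
    (\<forall>f. length (filter f [0..<k]) \<noteq> length (filter Q B) \<longrightarrow> \<epsilon> f = 0) \<and>
    (\<forall>g. bracket g [0..<k] B = (\<Sum>f\<in>{0..<k} \<rightarrow>\<^sub>E UNIV. \<epsilon> f *
      bracket g (filter f [0..<k]) (filter Q B) *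
      bracket g (filter (\<lambda>i. \<not> f i) [0..<k]) (filter (\<lambda>b. \<not> Q b) B)))"
proof -
  have "\<forall>f. \<exists>\<epsilon>::'k. (length (filter f [0..<k]) = length (filter Q B) \<longrightarrow> \<epsilon> \<in> {1, -1}) \<and>
    (length (filter f [0..<k]) \<noteq> length (filter Q B) \<longrightarrow> \<epsilon> = 0) \<and>
    (\<forall>g. bracket (\<lambda>a b. if f a = Q b then g a b else 0) [0..<k] B =
      \<epsilon> * bracket g (filter f [0..<k]) (filter Q B) *
        bracket g (filter (\<lambda>a. \<not> f a) [0..<k]) (filter (\<lambda>b. \<not> Q b) B))"
    by (intro allI bracket_block_filter) (simp add: assms)
  from choice[OF this] obtain \<epsilon> :: "(nat \<Rightarrow> bool) \<Rightarrow> 'k" where \<epsilon>: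
    "\<And>f. length (filter f [0..<k]) = length (filter Q B) \<Longrightarrow> \<epsilon> f \<in> {1, -1}"
    "\<And>f. length (filter f [0..<k]) \<noteq> length (filter Q B) \<Longrightarrow> \<epsilon> f = 0"
    "\<And>f g. bracket (\<lambda>a b. if f a = Q b then g a b else 0) [0..<k] B =
      \<epsilon> f * bracket g (filter f [0..<k]) (filter Q B) *
        bracket g (filter (\<lambda>a. \<not> f a) [0..<k]) (filter (\<lambda>b. \<not> Q b) B)"
    by blast
  have "bracket g [0..<k] B = (\<Sum>f\<in>{0..<k} \<rightarrow>\<^sub>E UNIV. \<epsilon> f *
      bracket g (filter f [0..<k]) (filter Q B) *
      bracket g (filter (\<lambda>i. \<not> f i) [0..<k]) (filter (\<lambda>b. \<not> Q b) B))" for g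
  proof -
    have "bracket g [0..<k] B = bracket (\<lambda>a b. \<Sum>c\<in>UNIV. if c = Q b then g a b else 0) [0..<k] B"
      using assms by (intro bracket_cong) (auto simp: UNIV_bool)
    also have "\<dots> = (\<Sum>f\<in>{0..<k} \<rightarrow>\<^sub>E UNIV. bracket (\<lambda>a b. if f a = Q b then g a b else 0) [0..<k] B)"
      using assms by (subst bracket_sum_rows)
        (auto simp: bracket_def intro!: sum.cong arg_cong[where f = det] eq_matI)
    finally show ?thesis by (simp only: \<epsilon>(3))
  qed
  then show ?thesis using \<epsilon>(1,2) by (intro exI[of _ \<epsilon>]) blast
qed

lemma bracket_laplace_cols:
  fixes P :: "'a \<Rightarrow> bool"
  assumes "length A = k"
  shows "\<exists>\<epsilon> :: (nat \<Rightarrow> bool) \<Rightarrow> 'k::idom.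
    (\<forall>h. length (filter P A) \<noteq> length (filter h [0..<k]) \<longrightarrow> \<epsilon> h = 0) \<and>
    (\<forall>g. bracket g A [0..<k] = (\<Sum>h\<in>{0..<k} \<rightarrow>\<^sub>E UNIV. \<epsilon> h *
      bracket g (filter P A) (filter h [0..<k]) *
      bracket g (filter (\<lambda>a. \<not> P a) A) (filter (\<lambda>i. \<not> h i) [0..<k])))"
proof -
  obtain \<epsilon> :: "(nat \<Rightarrow> bool) \<Rightarrow> 'k" where \<epsilon>:
    "\<And>f. length (filter f [0..<k]) \<noteq> length (filter P A) \<Longrightarrow> \<epsilon> f = 0"
    "\<And>g. bracket g [0..<k] A = (\<Sum>f\<in>{0..<k} \<rightarrow>\<^sub>E UNIV. \<epsilon> f *
      bracket g (filter f [0..<k]) (filter P A) *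
      bracket g (filter (\<lambda>i. \<not> f i) [0..<k]) (filter (\<lambda>b. \<not> P b) A))"
    using bracket_laplace_rows[OF assms, of P, where 'k = 'k] by blast
  have "bracket g A [0..<k] = (\<Sum>h\<in>{0..<k} \<rightarrow>\<^sub>E UNIV. \<epsilon> h *
      bracket g (filter P A) (filter h [0..<k]) *
      bracket g (filter (\<lambda>a. \<not> P a) A) (filter (\<lambda>i. \<not> h i) [0..<k]))" for g
  proof -
    have "\<epsilon> f * bracket (\<lambda>i a. g a i) (filter f [0..<k]) (filter P A) *
      bracket (\<lambda>i a. g a i) (filter (\<lambda>i. \<not> f i) [0..<k]) (filter (\<lambda>b. \<not> P b) A) =
      \<epsilon> f * bracket g (filter P A) (filter f [0..<k]) *
      bracket g (filter (\<lambda>a. \<not> P a) A) (filter (\<lambda>i. \<not> f i) [0..<k])" for f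
    proof (cases "length (filter f [0..<k]) = length (filter P A)")
      case True
      then have "length (filter (\<lambda>i. \<not> f i) [0..<k]) = length (filter (\<lambda>b. \<not> P b) A)"
        using assms sum_length_filter_compl[of f "[0..<k]"] sum_length_filter_compl[of P A] by simp
      then show ?thesis
        using True by (simp add: bracket_transpose[of "filter f [0..<k]"]
          bracket_transpose[of "filter (\<lambda>i. \<not> f i) [0..<k]"])
    qed (simp add: \<epsilon>(1))
    then show ?thesis
      using assms \<epsilon>(2)[of "\<lambda>i a. g a i"] by (simp only: bracket_transpose[of "[0..<k]" A] length_upt diff_zero)
  qed
  then show ?thesis using \<epsilon>(1) by (intro exI[of _ \<epsilon>]) auto
qed

section \<open>The exchange relation\<close>

lemma subspace_mult_const:
  assumes "fun_vs.subspace V" "f \<in> V"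
  shows "(\<lambda>x. c * f x) \<in> V"
  using fun_vs.subspace_scale[OF assms, of c] by (simp add: fscale_def)

lemma sum_fun_apply: "(\<Sum>i\<in>I. f i) x = (\<Sum>i\<in>I. f i x)"
  by (induction I rule: infinite_finite_induct) auto

lemma subspace_sum_fun:
  assumes "fun_vs.subspace V" "\<And>i. i \<in> I \<Longrightarrow> f i \<in> V"
  shows "(\<lambda>x. \<Sum>i\<in>I. f i x) \<in> V"
proof -
  have "(\<lambda>x. \<Sum>i\<in>I. f i x) = (\<Sum>i\<in>I. f i)" by (simp add: fun_eq_iff sum_fun_apply)
  then show ?thesis using fun_vs.subspace_sum[OF assms] by simp
qed

text \<open>
  The form in which a linear relation with an invertible coefficient is used: one term is
  expressed by the others.
\<close>

lemma subspace_isolate_term: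
  fixes f :: "'i \<Rightarrow> 'x \<Rightarrow> 'k::field"
  assumes V: "fun_vs.subspace V" and "finite I" "i0 \<in> I"
    and sum: "(\<lambda>x. \<Sum>i\<in>I. f i x) \<in> V" and other: "\<And>i. i \<in> I \<Longrightarrow> i \<noteq> i0 \<Longrightarrow> f i \<in> V"
    and tm: "\<And>x. f i0 x = c * h x" "c \<noteq> 0"
  shows "h \<in> V"
proof -
  have "(\<lambda>x. \<Sum>i\<in>I - {i0}. f i x) \<in> V"
    by (rule subspace_sum_fun[OF V]) (use other in auto)
  then have "(\<lambda>x. \<Sum>i\<in>I. f i x) - (\<lambda>x. \<Sum>i\<in>I - {i0}. f i x) \<in> V"
    by (rule fun_vs.subspace_diff[OF V sum])
  also have "(\<lambda>x. \<Sum>i\<in>I. f i x) - (\<lambda>x. \<Sum>i\<in>I - {i0}. f i x) = f i0"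
    using assms(2,3) by (simp add: fun_eq_iff sum.remove)
  finally have "(\<lambda>x. inverse c * f i0 x) \<in> V"
    by (rule subspace_mult_const[OF V])
  also have "(\<lambda>x. inverse c * f i0 x) = h"
    using tm by (simp add: fun_eq_iff)
  finally show ?thesis .
qed

lemma sum_list_map_filter_upt:
  "sum_list (map v (filter f [0..<k])) = (\<Sum>i | i < k \<and> f i. v i)"
proof -
  have "sum_list (map v (filter f [0..<k])) = sum v (set (filter f [0..<k]))"
    by (rule sum.distinct_set_conv_list[symmetric]) simp
  also have "set (filter f [0..<k]) = {i. i < k \<and> f i}" by auto
  finally show ?thesis .
qed

text \<open>
  A shuffle replaces some of the first \<open>r\<close> positions by equally many later positions with larger
  values, so it increases the sum.
\<close>

lemma shuffle_sum_less:
  fixes v :: "nat \<Rightarrow> nat"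
  assumes "r \<le> k" "card {i. i < k \<and> f i} = r"
    and less: "\<And>i i'. i < r \<Longrightarrow> \<not> f i \<Longrightarrow> r \<le> i' \<Longrightarrow> i' < k \<Longrightarrow> f i' \<Longrightarrow> v i < v i'"
    and ne: "\<exists>i<k. f i \<noteq> (i < r)"
  shows "(\<Sum>i<r. v i) < (\<Sum>i | i < k \<and> f i. v i)"
proof -
  let ?I = "{i. i < k \<and> f i}"
  let ?S1 = "{i. i < r \<and> \<not> f i}" and ?S2 = "{i. r \<le> i \<and> i < k \<and> f i}" and ?M = "{i. i < r \<and> f i}"
  have u1: "{..<r} = ?M \<union> ?S1" and u2: "?I = ?M \<union> ?S2" using assms(1) by auto
  have c1: "card {..<r} = card ?M + card ?S1"
    by (subst u1, rule card_Un_disjoint) auto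
  have c2: "card ?I = card ?M + card ?S2"
    by (subst u2, rule card_Un_disjoint) auto
  have c: "card ?S1 = card ?S2" using c1 c2 assms(2) by simp
  have fin: "finite ?S1" "finite ?S2" by auto
  have ne2: "?S2 \<noteq> {}"
  proof
    assume "?S2 = {}"
    then have "card ?S1 = 0" using c by (simp only: card.empty)
    then have "?S1 = {}" using fin by (simp only: card_0_eq)
    then show False using ne \<open>?S2 = {}\<close> assms(1) by (metis (mono_tags, lifting) empty_Collect_eq not_less)
  qed
  then have ne1: "?S1 \<noteq> {}" using c fin by (metis card.empty card_eq_0_iff)
  define a where "a = Max (v ` ?S1)"
  have a: "v i \<le> a" if "i \<in> ?S1" for i using that fin unfolding a_def by simp
  have "a \<in> v ` ?S1" unfolding a_def using fin ne1 by (intro Max_in) auto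
  then have b: "Suc a \<le> v i" if "i \<in> ?S2" for i using less that by (auto simp: Suc_le_eq)
  have "sum v ?S1 \<le> card ?S1 * a" using sum_bounded_above[of ?S1 v a] a by simp
  also have "\<dots> < card ?S2 * Suc a" using c ne2 fin by (simp add: card_gt_0_iff)
  also have "\<dots> \<le> sum v ?S2" using sum_bounded_below[of ?S2 "Suc a" v] b by simp
  finally have "sum v ?S1 < sum v ?S2" .
  moreover have "sum v {..<r} = sum v ?M + sum v ?S1" by (subst u1, rule sum.union_disjoint) auto
  moreover have "sum v ?I = sum v ?M + sum v ?S2" by (subst u2, rule sum.union_disjoint) auto
  ultimately show ?thesis by simp
qed

text \<open>
  The straightening relation for two factors, for a family of pairings \<open>g x\<close>. The rows \<open>a\<^sub>1, \<dots>, a\<^sub>j,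
  c\<^sub>j, \<dots>, c\<^sub>l\<close> are shuffled between the two factors. The two kinds of correction terms are those of
  \<open>same\<close> (same shape, larger labels in the first factor) and \<open>long\<close> (a larger minor). The
  factor \<open>F\<close> stands for the other factors of a monomial.
\<close>

lemma garnir_exchange:
  fixes g :: "'x \<Rightarrow> nat \<Rightarrow> 'b \<Rightarrow> 'k::field"
  assumes V: "fun_vs.subspace V"
    and len: "length B = length A" "length D = length C" "length A \<le> length C"
    and sorted: "sorted A" "sorted C"
    and viol: "j < length A" "A ! j < C ! j"
    and same: "\<And>A' C'. length A' = length A \<Longrightarrow> length C' = length C \<Longrightarrow>
      set A' \<union> set C' \<subseteq> set A \<union> set C \<Longrightarrow>
      sum_list A' + sum_list C' = sum_list A + sum_list C \<Longrightarrow> sum_list A < sum_list A' \<Longrightarrow>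
      (\<lambda>x. F x * bracket (g x) A' B * bracket (g x) C' D) \<in> V"
    and long: "\<And>Y T A' B' C' D'. length Y = Suc (length C) \<Longrightarrow> length T = length Y \<Longrightarrow>
      length B' = length A' \<Longrightarrow> length D' = length C' \<Longrightarrow> Suc (length A' + length C') = length A \<Longrightarrow>
      set Y \<union> set A' \<union> set C' \<subseteq> set A \<union> set C \<Longrightarrow> set T \<union> set B' \<union> set D' \<subseteq> set B \<union> set D \<Longrightarrow>
      (\<lambda>x. F x * bracket (g x) Y T * bracket (g x) A' B' * bracket (g x) C' D') \<in> V"
  shows "(\<lambda>x. F x * bracket (g x) A B * bracket (g x) C D) \<in> V"
proof -
  define r l where "r = length A" and "l = length C"
  define k where "k = r + l"
  define v where "v i = (A @ C) ! i" for i
  define w where "w i = (B @ D) ! i" for i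
  define xr where "xr i \<longleftrightarrow> i \<le> j \<or> r + j \<le> i" for i
  define lo where "lo i \<longleftrightarrow> i < r" for i
  \<comment> \<open>The rows \<open>xr\<close> are those to be shuffled; the other rows only meet the columns of their own factor.\<close>
  define M where "M x i i' = (if xr i \<or> lo i = lo i' then g x (v i) (w i') else 0)" for x i i'
  have j: "j < r" "j < l" using viol(1) len by (auto simp: r_def l_def)
  have rk: "r \<le> k" by (simp add: k_def)
  have upt: "[0..<k] = [0..<r] @ [r..<k]" unfolding k_def by (rule upt_add_eq_append) simp
  have flo: "filter lo [0..<k] = [0..<r]" "filter (\<lambda>i. \<not> lo i) [0..<k] = [r..<k]"
    unfolding upt filter_append by (auto simp: lo_def filter_empty_conv filter_id_conv)
  have vA: "map v [0..<r] = A" unfolding v_def r_def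
    by (rule nth_equalityI) (auto simp: nth_append)
  have wB: "map w [0..<r] = B" unfolding w_def r_def
    by (rule nth_equalityI) (auto simp: nth_append len)
  have vC: "map v [r..<k] = C" unfolding v_def r_def k_def l_def
    by (rule nth_equalityI) (auto simp: nth_append)
  have wD: "map w [r..<k] = D" unfolding w_def r_def k_def l_def
    by (rule nth_equalityI) (auto simp: nth_append len)
  have v_in: "v i \<in> set A \<union> set C" if "i < k" for i
    using that nth_mem[of i "A @ C"] by (simp add: v_def k_def r_def l_def)
  have w_in: "w i \<in> set B \<union> set D" if "i < k" for i
    using that nth_mem[of i "B @ D"] by (simp add: w_def k_def r_def l_def len)
  have zero: "(\<lambda>x. 0) \<in> V" using fun_vs.subspace_0[OF V] by (simp add: zero_fun_def)

  \<comment> \<open>Expansion along the \<open>l + 1\<close> shuffled rows.\<close>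
  have total: "(\<lambda>x. F x * bracket (M x) [0..<k] [0..<k]) \<in> V"
  proof -
    obtain \<delta> :: "(nat \<Rightarrow> bool) \<Rightarrow> 'k" where \<delta>:
      "\<And>h. length (filter xr [0..<k]) \<noteq> length (filter h [0..<k]) \<Longrightarrow> \<delta> h = 0"
      "\<And>g. bracket g [0..<k] [0..<k] = (\<Sum>h\<in>{0..<k} \<rightarrow>\<^sub>E UNIV. \<delta> h *
        bracket g (filter xr [0..<k]) (filter h [0..<k]) *
        bracket g (filter (\<lambda>i. \<not> xr i) [0..<k]) (filter (\<lambda>i. \<not> h i) [0..<k]))"
      using bracket_laplace_cols[of "[0..<k]" k xr, where 'k = 'k] by auto
    have fxr: "length (filter xr [0..<k]) = Suc l"
    proof -
      have "length (filter xr [0..<k]) = card {i. i < k \<and> xr i}"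
        by (subst distinct_length_filter) (auto intro!: arg_cong[where f = card])
      also have "{i. i < k \<and> xr i} = {..j} \<union> {r + j..<k}"
        using j rk by (auto simp: xr_def)
      also have "card \<dots> = Suc j + (k - (r + j))"
        using j by (subst card_Un_disjoint) auto
      finally show ?thesis using j by (simp add: k_def)
    qed
    have "(\<lambda>x. F x * (\<delta> h * bracket (M x) (filter xr [0..<k]) (filter h [0..<k]) *
        bracket (M x) (filter (\<lambda>i. \<not> xr i) [0..<k]) (filter (\<lambda>i. \<not> h i) [0..<k]))) \<in> V"
      (is "(\<lambda>x. F x * (\<delta> h * ?b1 x * ?b2 x)) \<in> V") for h
    proof (cases "length (filter xr [0..<k]) = length (filter h [0..<k])")
      case True
      let ?R = "filter (\<lambda>i. \<not> xr i) [0..<k]" and ?H = "filter (\<lambda>i. \<not> h i) [0..<k]"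
      have lenRH: "length ?H = length ?R"
        using True sum_length_filter_compl[of xr "[0..<k]"] sum_length_filter_compl[of h "[0..<k]"] by simp
      have b1: "?b1 x = bracket (g x) (map v (filter xr [0..<k])) (map w (filter h [0..<k]))" for x
        using True by (subst bracket_map) (auto simp: M_def intro!: bracket_cong)
      \<comment> \<open>The remaining rows still form a block matrix, which splits the second factor in two.\<close>
      have b2: "?b2 x = bracket (\<lambda>i i'. if lo i = lo i' then g x (v i) (w i') else 0) ?R ?H" for x
        using lenRH by (intro bracket_cong) (auto simp: M_def)
      obtain \<epsilon> :: 'k where \<epsilon>:
        "length (filter lo ?R) \<noteq> length (filter lo ?H) \<Longrightarrow> \<epsilon> = 0"
        "\<And>g. bracket (\<lambda>a b. if lo a = lo b then g a b else 0) ?R ?H =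
          \<epsilon> * bracket g (filter lo ?R) (filter lo ?H) *
          bracket g (filter (\<lambda>a. \<not> lo a) ?R) (filter (\<lambda>b. \<not> lo b) ?H)"
        using bracket_block_filter[OF lenRH, of lo lo, where 'k = 'k] by blast
      show ?thesis
      proof (cases "length (filter lo ?R) = length (filter lo ?H)")
        case True': True
        have len2: "length (filter (\<lambda>a. \<not> lo a) ?R) = length (filter (\<lambda>b. \<not> lo b) ?H)"
          using True' lenRH sum_length_filter_compl[of lo ?R] sum_length_filter_compl[of lo ?H] by simp
        have lenR: "length (filter lo ?R) + length (filter (\<lambda>a. \<not> lo a) ?R) + Suc l = k"
          using sum_length_filter_compl[of lo ?R] sum_length_filter_compl[of xr "[0..<k]"] fxr by simp
        have "(\<lambda>x. F x * bracket (g x) (map v (filter xr [0..<k])) (map w (filter h [0..<k])) *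
            bracket (g x) (map v (filter lo ?R)) (map w (filter lo ?H)) *
            bracket (g x) (map v (filter (\<lambda>a. \<not> lo a) ?R)) (map w (filter (\<lambda>b. \<not> lo b) ?H))) \<in> V"
          using fxr True True' len2 lenR v_in w_in
          by (intro long) (auto simp: l_def[symmetric] r_def[symmetric] k_def)
        from subspace_mult_const[OF V this, of "\<delta> h * \<epsilon>"] show ?thesis
          unfolding b1 b2 \<epsilon>(2) using True' len2 by (simp add: bracket_map mult_ac)
      qed (use zero \<epsilon> b2 in simp)
    qed (use zero \<delta>(1) in simp)
    then show ?thesis
      unfolding \<delta>(2) sum_distrib_left by (intro subspace_sum_fun[OF V])
  qed

  obtain \<epsilon> :: "(nat \<Rightarrow> bool) \<Rightarrow> 'k" where \<epsilon>:
    "\<And>f. length (filter f [0..<k]) = length (filter lo [0..<k]) \<Longrightarrow> \<epsilon> f \<in> {1, -1}"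
    "\<And>f. length (filter f [0..<k]) \<noteq> length (filter lo [0..<k]) \<Longrightarrow> \<epsilon> f = 0"
    "\<And>g. bracket g [0..<k] [0..<k] = (\<Sum>f\<in>{0..<k} \<rightarrow>\<^sub>E UNIV. \<epsilon> f *
      bracket g (filter f [0..<k]) (filter lo [0..<k]) *
      bracket g (filter (\<lambda>i. \<not> f i) [0..<k]) (filter (\<lambda>i. \<not> lo i) [0..<k]))"
    using bracket_laplace_rows[of "[0..<k]" k lo, where 'k = 'k] by auto
  \<comment> \<open>Expansion along the columns of \<open>B\<close>; the rows coloured by \<open>f\<close> form the first factor.\<close>
  let ?t = "\<lambda>f x. F x * (\<epsilon> f * bracket (M x) (filter f [0..<k]) [0..<r] *
      bracket (M x) (filter (\<lambda>i. \<not> f i) [0..<k]) [r..<k])"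
  have tm: "?t f x = \<epsilon> f * (F x * bracket (g x) (map v (filter f [0..<k])) B *
      bracket (g x) (map v (filter (\<lambda>i. \<not> f i) [0..<k])) D)"
    if agree: "\<And>i. i < k \<Longrightarrow> xr i \<or> f i = lo i" for f x
  proof (cases "length (filter f [0..<k]) = length (filter lo [0..<k])")
    case True
    then have l1: "length (filter f [0..<k]) = r" unfolding flo by simp
    then have l2: "length (filter (\<lambda>i. \<not> f i) [0..<k]) = k - r"
      using sum_length_filter_compl[of f "[0..<k]"] by simp
    have "bracket (M x) (filter f [0..<k]) [0..<r] = bracket (g x) (map v (filter f [0..<k])) B"
      unfolding wB[symmetric] using l1
      by (subst bracket_map) (auto simp: M_def lo_def dest: agree[unfolded lo_def] intro!: bracket_cong)
    moreover have "bracket (M x) (filter (\<lambda>i. \<not> f i) [0..<k]) [r..<k] =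
        bracket (g x) (map v (filter (\<lambda>i. \<not> f i) [0..<k])) D"
      unfolding wD[symmetric] using l2
      by (subst bracket_map) (auto simp: M_def lo_def dest: agree[unfolded lo_def] intro!: bracket_cong)
    ultimately show ?thesis by simp
  qed (simp add: \<epsilon>(2))
  define f0 where "f0 = restrict lo {0..<k}"
  have f0: "filter f0 [0..<k] = [0..<r]" "filter (\<lambda>i. \<not> f0 i) [0..<k] = [r..<k]"
    unfolding flo[symmetric] by (auto simp: f0_def intro!: filter_cong)
  show ?thesis
  proof (rule subspace_isolate_term[OF V, where I = "{0..<k} \<rightarrow>\<^sub>E UNIV" and ?i0.0 = f0 and f = ?t and c = "\<epsilon> f0"])
    show "finite ({0..<k} \<rightarrow>\<^sub>E (UNIV :: bool set))" by (intro finite_PiE) auto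
    show "f0 \<in> {0..<k} \<rightarrow>\<^sub>E UNIV" by (auto simp: f0_def)
    show "(\<lambda>x. \<Sum>f\<in>{0..<k} \<rightarrow>\<^sub>E UNIV. ?t f x) \<in> V"
      using total unfolding \<epsilon>(3) flo sum_distrib_left .
    show "\<epsilon> f0 \<noteq> 0" using \<epsilon>(1)[of f0] unfolding f0 flo by auto
    show "?t f0 x = \<epsilon> f0 * (F x * bracket (g x) A B * bracket (g x) C D)" for x
      using tm[of f0 x] unfolding f0 vA vC by (auto simp: f0_def)
    fix f assume f: "f \<in> {0..<k} \<rightarrow>\<^sub>E (UNIV :: bool set)" "f \<noteq> f0"
    show "?t f \<in> V"
    proof (cases "length (filter f [0..<k]) = length (filter lo [0..<k])")
      case True
      then have l1: "length (filter f [0..<k]) = r" unfolding flo by simp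
      then have l2: "length (filter (\<lambda>i. \<not> f i) [0..<k]) = l"
        using sum_length_filter_compl[of f "[0..<k]"] by (simp add: k_def)
      show ?thesis
      proof (cases "\<forall>i<k. xr i \<or> f i = lo i")
        case False
        then obtain i where i: "i < k" "\<not> xr i" "f i \<noteq> lo i" by blast
        have "bracket (M x) (filter f [0..<k]) [0..<r] *
          bracket (M x) (filter (\<lambda>i. \<not> f i) [0..<k]) [r..<k] = 0" for x
        proof (cases "f i")
          case True
          then have "bracket (M x) (filter f [0..<k]) [0..<r] = 0"
            using i l1 by (intro bracket_zero_row[of i]) (auto simp: M_def lo_def)
          then show ?thesis by simp
        next
          case False
          then have "bracket (M x) (filter (\<lambda>i. \<not> f i) [0..<k]) [r..<k] = 0"
            using i l2 by (intro bracket_zero_row[of i]) (auto simp: M_def lo_def k_def)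
          then show ?thesis by simp
        qed
        then have "?t f = (\<lambda>x. 0)" by (simp only: mult.assoc mult_zero_right)
        then show ?thesis using zero by (simp only:)
      next
        case agree: True
        have ne: "\<exists>i<k. f i \<noteq> (i < r)"
        proof (rule ccontr)
          assume "\<not> ?thesis"
          then have "f = f0" using f(1) by (auto simp: f0_def lo_def fun_eq_iff PiE_def extensional_def)
          then show False using f(2) by simp
        qed
        have card: "card {i. i < k \<and> f i} = r"
        proof -
          have "length (filter f [0..<k]) = card {i. i < k \<and> f i}"
            by (subst distinct_length_filter) (auto intro!: arg_cong[where f = card])
          then show ?thesis using l1 by simp
        qed
        have sA: "sum_list A = (\<Sum>i<r. v i)"
          unfolding vA[symmetric] by (simp add: interv_sum_list_conv_sum_set_nat atLeast0LessThan)
        have less: "sum_list A < sum_list (map v (filter f [0..<k]))"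
          unfolding sum_list_map_filter_upt sA
        proof (rule shuffle_sum_less[OF rk card _ ne])
          fix i i' assume i: "i < r" "\<not> f i" "r \<le> i'" "i' < k" "f i'"
          have "i \<le> j" using agree[rule_format, of i] i rk by (auto simp: xr_def lo_def)
          then have "v i \<le> A ! j" using i viol sorted
            by (auto simp: v_def r_def nth_append intro: sorted_nth_mono)
          moreover have "r + j \<le> i'" using agree[rule_format, of i'] i j by (auto simp: xr_def lo_def)
          then have "C ! j \<le> v i'" using i sorted
            by (auto simp: v_def r_def l_def k_def nth_append intro!: sorted_nth_mono)
          ultimately show "v i < v i'" using viol(2) by simp
        qed
        have tot: "sum_list (map v (filter f [0..<k])) + sum_list (map v (filter (\<lambda>i. \<not> f i) [0..<k])) =
            sum_list A + sum_list C"
        proof -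
          have "sum_list (map v (filter f is)) + sum_list (map v (filter (\<lambda>i. \<not> f i) is)) =
            sum_list (map v is)" for "is"
            by (induction "is") auto
          note this[of "[0..<k]"]
          also have "map v [0..<k] = A @ C" unfolding upt map_append vA vC ..
          finally show ?thesis by simp
        qed
        have "(\<lambda>x. F x * bracket (g x) (map v (filter f [0..<k])) B *
            bracket (g x) (map v (filter (\<lambda>i. \<not> f i) [0..<k])) D) \<in> V"
          using l1 l2 less tot v_in by (intro same) (auto simp: r_def l_def)
        from subspace_mult_const[OF V this, of "\<epsilon> f"] show ?thesis
          using agree by (subst (asm) tm[symmetric]) auto
      qed
    qed (use zero \<epsilon>(2) in simp)
  qed
qed

section \<open>Straightening\<close>

definition word_fun :: "('x \<Rightarrow> 'a \<Rightarrow> 'b \<Rightarrow> 'k::comm_ring_1) \<Rightarrow> ('a list \<times> 'b list) list \<Rightarrow> 'x \<Rightarrow> 'k" where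
  "word_fun g w x = (\<Prod>(A, B)\<leftarrow>w. bracket (g x) A B)"

lemma word_fun_Nil [simp]: "word_fun g [] x = 1"
  and word_fun_Cons [simp]: "word_fun g ((A, B) # w) x = bracket (g x) A B * word_fun g w x"
  and word_fun_append [simp]: "word_fun g (w @ w') x = word_fun g w x * word_fun g w' x"
  by (simp_all add: word_fun_def)

text \<open>
  Column labels below \<open>n\<close> are the coordinate covectors of \<open>V\<close>, and \<open>n + j\<close> is \<open>\<xi>\<^sub>j\<close>. So a row
  \<open>(A, B)\<close> is either a factor \<open>p(A, B)\<close> or, if \<open>B = [0..<n]\<close>, a factor \<open>u(A)\<close>. The coordinate
  covectors come first, so that \<open>[0..<n]\<close> lies below every admissible \<open>B\<close>, just as \<open>u(I)\<close> may only
  follow the factors \<open>p(A, B)\<close>.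
\<close>

definition admissible_row :: "nat \<Rightarrow> nat \<Rightarrow> nat \<Rightarrow> nat list \<times> nat list \<Rightarrow> bool" where
  "admissible_row n m q = (\<lambda>(A, B). length B = length A \<and> 1 \<le> length A \<and> length A \<le> n \<and> set A \<subseteq> {..<m} \<and>
     (set B \<subseteq> {n..<n + q} \<or> B = [0..<n]))"

text \<open>
  Sorting by this key puts shorter minors first and the factors \<open>u(I)\<close> last.
\<close>

definition row_key :: "nat \<Rightarrow> nat list \<times> nat list \<Rightarrow> nat" where
  "row_key n = (\<lambda>(A, B). if set B \<subseteq> {n..} then length A else Suc n)"

definition valid_word :: "nat \<Rightarrow> nat \<Rightarrow> nat \<Rightarrow> (nat list \<times> nat list) list \<Rightarrow> bool" where
  "valid_word n m q w \<longleftrightarrow> (\<forall>p\<in>set w. admissible_row n m q p) \<and> sorted (map (row_key n) w)"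

definition pair_ge :: "nat list \<times> nat list \<Rightarrow> nat list \<times> nat list \<Rightarrow> bool" where
  "pair_ge = (\<lambda>(A, B) (C, D). idx_ge A C \<and> idx_ge B D)"

definition standard_word :: "nat \<Rightarrow> nat \<Rightarrow> nat \<Rightarrow> (nat list \<times> nat list) list \<Rightarrow> bool" where
  "standard_word n m q w \<longleftrightarrow> valid_word n m q w \<and>
     (\<forall>(A, B)\<in>set w. sorted_wrt (<) A \<and> sorted_wrt (<) B) \<and>
     sorted_wrt pair_ge w"

text \<open>
  The first termination measure. The sum of \<open>3 ^ l\<close> over the sizes of the minors grows when a
  minor of size \<open>l + 1\<close> is formed from two minors of size at most \<open>l\<close>. The total size
  is constant, so subtracting from \<open>l * 3 ^ n\<close>, which keeps the value nonnegative for \<open>l \<le> n\<close>, turns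
  growth into descent; the summand 1 makes the defect of an empty minor 0.
\<close>

definition defect :: "nat \<Rightarrow> nat \<Rightarrow> nat" where
  "defect n l = l * 3 ^ n + 1 - 3 ^ l"

lemma defect_0 [simp]: "defect n 0 = 0"
  by (simp add: defect_def)

lemma defect_less:
  assumes "r \<le> l" "l < n" "Suc (a + c) = r"
  shows "defect n (Suc l) + defect n a + defect n c < defect n r + defect n l"
proof -
  have d: "defect n i + 3 ^ i = i * 3 ^ n + 1" if "i \<le> n" for i
  proof (cases "i = 0")
    case False
    have "3 ^ i \<le> (3::nat) ^ n" using that by simp
    also have "\<dots> \<le> i * 3 ^ n" using False by simp
    finally show ?thesis by (simp add: defect_def)
  qed (simp add: defect_def)
  have d5: "defect n (Suc l) + 3 ^ Suc l = Suc l * 3 ^ n + 1" "defect n a + 3 ^ a = a * 3 ^ n + 1"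
    "defect n c + 3 ^ c = c * 3 ^ n + 1" "defect n r + 3 ^ r = r * 3 ^ n + 1" "defect n l + 3 ^ l = l * 3 ^ n + 1"
    by (rule d, use assms in linarith)+
  have "(3::nat) ^ r \<le> 3 ^ l" using assms(1) by simp
  moreover have "(1::nat) \<le> 3 ^ a" "(1::nat) \<le> 3 ^ c" by simp_all
  moreover have "Suc l * 3 ^ n + a * 3 ^ n + c * 3 ^ n = r * 3 ^ n + l * 3 ^ n"
    unfolding assms(3)[symmetric] by (simp add: algebra_simps)
  ultimately show ?thesis using d5 unfolding power_Suc by linarith
qed

text \<open>
  The second termination measure, for a fixed shape: the entries of a row are weighted by the
  position of the row, so moving larger entries to earlier rows lowers the weight.
\<close>

fun position_weight :: "nat \<Rightarrow> nat list list \<Rightarrow> nat" where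
  "position_weight c [] = 0"
| "position_weight c (A # As) = c * sum_list A + position_weight (Suc c) As"

lemma position_weight_append:
  "position_weight c (As @ Bs) = position_weight c As + position_weight (c + length As) Bs"
  by (induction As arbitrary: c) auto

lemma position_weight_exchange:
  assumes "sum_list A' + sum_list C' = sum_list A + sum_list C" "sum_list A < sum_list A'"
  shows "position_weight c (xs @ A' # ys @ C' # zs) < position_weight c (xs @ A # ys @ C # zs)"
proof -
  obtain d where d: "sum_list A' = sum_list A + d" "d > 0"
    using that[of "sum_list A' - sum_list A"] assms(2) by simp
  then have C: "sum_list C = sum_list C' + d" using assms(1) by linarith
  have "(c + length xs) * d < Suc (c + length xs + length ys) * d"
    using d(2) by (intro mult_strict_right_mono) auto
  then show ?thesis
    unfolding position_weight_append position_weight.simps d(1) C add_mult_distrib2 add_Suc by linarith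
qed

lemma position_weight_sort:
  "position_weight c (map (\<lambda>A. sort (f A)) As) = position_weight c (map f As)"
proof (induction As arbitrary: c)
  case (Cons A As)
  have "sum_list (sort (f A)) = sum_list (f A)" by (metis mset_sort sum_mset_sum_list)
  then show ?case using Cons by simp
qed simp

lemma word_fun_sort_rows:
  fixes g :: "'x \<Rightarrow> 'a::linorder \<Rightarrow> 'b::linorder \<Rightarrow> 'k::field"
  assumes "\<forall>(A, B)\<in>set w. length B = length A"
  shows "\<exists>c. \<forall>x. word_fun g w x = c * word_fun g (map (\<lambda>(A, B). (sort A, sort B)) w) x"
  using assms
proof (induction w)
  case (Cons p w)
  obtain A B where p: "p = (A, B)" by (cases p)
  have len: "length B = length A" using Cons.prems p by auto
  obtain c where c: "\<And>x. word_fun g w x = c * word_fun g (map (\<lambda>(A, B). (sort A, sort B)) w) x"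
    using Cons by auto
  obtain e1 :: 'k where e1: "\<And>g (B :: 'b list). length B = length (sort A) \<Longrightarrow> bracket g A B = e1 * bracket g (sort A) B"
    using bracket_perm_rows[of A "sort A", where 'b = 'b and 'k = 'k] unfolding mset_sort by blast
  obtain e2 :: 'k where e2: "\<And>g (A :: 'a list). length (sort B) = length A \<Longrightarrow> bracket g A B = e2 * bracket g A (sort B)"
    using bracket_perm_cols[of B "sort B", where 'b = 'a and 'k = 'k] unfolding mset_sort by blast
  have "bracket (g x) A B = e1 * e2 * bracket (g x) (sort A) (sort B)" for x
    using e1[of B "g x"] e2[of "sort A" "g x"] len by simp
  then show ?case unfolding p
    by (intro exI[of _ "e1 * e2 * c"]) (simp add: c)
qed (auto intro: exI[of _ 1])

lemma not_sorted_wrt_split: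
  assumes "\<not> sorted_wrt P w"
  shows "\<exists>xs a ys b zs. w = xs @ a # ys @ b # zs \<and> \<not> P a b"
  using assms
proof (induction w)
  case (Cons a w)
  show ?case
  proof (cases "\<forall>b\<in>set w. P a b")
    case True
    then have "\<not> sorted_wrt P w" using Cons.prems by simp
    then obtain xs b ys c zs where "w = xs @ b # ys @ c # zs" "\<not> P b c" using Cons.IH by blast
    then show ?thesis by (intro exI[of _ "a # xs"]) auto
  next
    case False
    then obtain b where "b \<in> set w" "\<not> P a b" by blast
    then show ?thesis by (metis append_Nil split_list)
  qed
qed simp

text \<open>
  Lexicographic induction on the two measures. A repeated label inside a row makes the function
  vanish, and sorting the labels inside each row changes neither measure and the function only by a
  sign; so only violations between two rows matter. If the
  longer row has size \<open>n\<close>, the exchange creates minors of size \<open>n + 1\<close>, which vanish; otherwise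
  neither row is a \<open>u(I)\<close>, and the enlarged word can be re-sorted, as its defect has dropped. A
  violation in the columns never involves a factor \<open>u(I)\<close> and is removed by the transposed
  exchange.
\<close>

theorem straightening:
  fixes g :: "'x \<Rightarrow> nat \<Rightarrow> nat \<Rightarrow> 'k::field"
  assumes V: "fun_vs.subspace V"
    and rank: "\<And>x A B. n < length A \<Longrightarrow> length B = length A \<Longrightarrow> bracket (g x) A B = 0"
    and std: "\<And>w. standard_word n m q w \<Longrightarrow> word_fun g w \<in> V"
    and w: "valid_word n m q w"
  shows "word_fun g w \<in> V"
proof -
  define \<mu>1 :: "(nat list \<times> nat list) list \<Rightarrow> nat" where
    "\<mu>1 w = (\<Sum>p\<leftarrow>w. defect n (length (fst p)))" for w
  define \<mu>2 :: "(nat list \<times> nat list) list \<Rightarrow> nat" where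
    "\<mu>2 w = position_weight 0 (map fst w) + position_weight 0 (map snd w)" for w
  have zero: "(\<lambda>x. 0) \<in> V" using fun_vs.subspace_0[OF V] by (simp add: zero_fun_def)
  show ?thesis using w
  proof (induction w rule: wf_induct_rule[OF wf_measures[of "[\<mu>1, \<mu>2]"]])
    case (1 w0)
    note valid0 = 1(2)
    have IH: "word_fun g w \<in> V" if "valid_word n m q w" "\<mu>1 w < \<mu>1 w0 \<or> \<mu>1 w = \<mu>1 w0 \<and> \<mu>2 w < \<mu>2 w0" for w
      using 1(1)[of w] that by auto
    have len0: "\<forall>(A, B)\<in>set w0. length B = length A"
      using valid0 by (auto simp: valid_word_def admissible_row_def)
    show ?case
    proof (cases "\<forall>(A, B)\<in>set w0. distinct A \<and> distinct B")
      case False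
      then obtain A B where AB: "(A, B) \<in> set w0" "\<not> distinct A \<or> \<not> distinct B" by blast
      have "bracket (g x) A B = 0" for x
        using AB len0 bracket_not_distinct_rows[of A B "g x"] bracket_not_distinct_cols[of B A "g x"] by fastforce
      then have "word_fun g w0 x = 0" for x
        using AB(1) by (auto simp: word_fun_def prod_list_zero_iff intro!: image_eqI[of _ _ "(A, B)"])
      then have "word_fun g w0 = (\<lambda>x. 0)" by auto
      then show ?thesis using zero by simp
    next
      case distinct: True
      define w where "w = map (\<lambda>(A, B). (sort A, sort B)) w0"
      have key: "row_key n (sort A, sort B) = row_key n (A, B)" for A B
        by (simp add: row_key_def)
      have "admissible_row n m q (sort A, sort B)" if "admissible_row n m q (A, B)" for A B
        using that sorted_sort_id[of "[0..<n]"] by (auto simp: admissible_row_def)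
      then have "\<forall>p\<in>set w. admissible_row n m q p"
        using valid0 by (auto simp: valid_word_def w_def)
      moreover have "map (row_key n) w = map (row_key n) w0"
        unfolding w_def by (auto simp: key)
      ultimately have valid: "valid_word n m q w"
        using valid0 unfolding valid_word_def by (simp only:)
      have \<mu>1: "\<mu>1 w = \<mu>1 w0"
        by (auto simp: \<mu>1_def w_def o_def case_prod_unfold)
      have \<mu>2: "\<mu>2 w = \<mu>2 w0"
        using position_weight_sort[of 0 fst w0] position_weight_sort[of 0 snd w0]
        by (simp add: \<mu>2_def w_def o_def case_prod_unfold)
      have strict: "\<forall>(A, B)\<in>set w. sorted_wrt (<) A \<and> sorted_wrt (<) B"
        using distinct unfolding w_def by (auto simp: strict_sorted_iff)
      have "word_fun g w \<in> V"
      proof (cases "sorted_wrt pair_ge w")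
        case True
        then show ?thesis using std valid strict by (simp add: standard_word_def)
      next
        case False
        from not_sorted_wrt_split[OF this] obtain xs A B ys C D zs
          where ws: "w = xs @ (A, B) # ys @ (C, D) # zs" and viol: "\<not> (idx_ge A C \<and> idx_ge B D)"
          by (fastforce simp: pair_ge_def)
        have okAB: "admissible_row n m q (A, B)" and okCD: "admissible_row n m q (C, D)"
          and oks: "\<forall>p\<in>set (xs @ ys @ zs). admissible_row n m q p"
          and le: "row_key n (A, B) \<le> row_key n (C, D)"
          using valid by (auto simp: valid_word_def ws sorted_append)
        have len: "length B = length A" "length D = length C" "length C \<le> n" "length A \<le> length C"
          "set A \<union> set C \<subseteq> {..<m}"
          using okAB okCD le by (auto simp: admissible_row_def row_key_def split: if_splits)
        have sorted: "sorted A" "sorted B" "sorted C" "sorted D"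
          using strict ws by (auto simp: strict_sorted_iff)
        have n1: "1 \<le> n" using len okAB by (auto simp: admissible_row_def)
        define F where "F x = word_fun g xs x * word_fun g ys x * word_fun g zs x" for x
        have in_V: "(\<lambda>x. F x * bracket (g x) A' B' * bracket (g x) C' D') \<in> V"
          if "admissible_row n m q (A', B')" "admissible_row n m q (C', D')"
            "row_key n (A', B') = row_key n (A, B)" "row_key n (C', D') = row_key n (C, D)"
            "length A' = length A" "length C' = length C"
            "position_weight 0 (map fst xs @ A' # map fst ys @ C' # map fst zs) +
              position_weight 0 (map snd xs @ B' # map snd ys @ D' # map snd zs) < \<mu>2 w"
          for A' B' C' D'
        proof -
          let ?w = "xs @ (A', B') # ys @ (C', D') # zs"
          have "map (row_key n) ?w = map (row_key n) w" using that by (simp add: ws)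
          then have "valid_word n m q ?w"
            using that(1,2) oks valid by (auto simp: valid_word_def)
          moreover have "\<mu>1 ?w = \<mu>1 w" using that by (simp add: \<mu>1_def ws)
          moreover have "\<mu>2 ?w < \<mu>2 w" using that(7) by (simp add: \<mu>2_def)
          ultimately have "word_fun g ?w \<in> V" using IH \<mu>1 \<mu>2 by simp
          also have "word_fun g ?w = (\<lambda>x. F x * bracket (g x) A' B' * bracket (g x) C' D')"
            by (simp add: fun_eq_iff F_def)
          finally show ?thesis .
        qed
        have in_V_long: "(\<lambda>x. F x * bracket (g x) Y T * bracket (g x) A' B' * bracket (g x) C' D') \<in> V"
          if "length Y = Suc (length C)" "length T = length Y" "length B' = length A'" "length D' = length C'"
            "Suc (length A' + length C') = length A"
            "set Y \<union> set A' \<union> set C' \<subseteq> set A \<union> set C" "set T \<union> set B' \<union> set D' \<subseteq> set B \<union> set D"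
          for Y T A' B' C' D'
        proof (cases "length C = n")
          case True
          then have "bracket (g x) Y T = 0" for x using that by (intro rank) auto
          then show ?thesis using zero by simp
        next
          case False
          then have "length C < n" using len by simp
          then have "set D \<subseteq> {n..<n + q}" using okCD by (auto simp: admissible_row_def)
          moreover from this have "row_key n (C, D) \<le> n" using len by (auto simp: row_key_def)
          then have "set B \<subseteq> {n..<n + q}" using okAB le n1
            by (auto simp: admissible_row_def row_key_def split: if_splits)
          ultimately have BD: "set T \<union> set B' \<union> set D' \<subseteq> {n..<n + q}" using that(7) by auto
          \<comment> \<open>The exchange may leave minors of size 0, which are equal to 1 and are removed.\<close>
          define w1 where "w1 = xs @ ys @ zs @ [(Y, T), (A', B'), (C', D')]"
          define w2 where "w2 = sort_key (row_key n) (filter (\<lambda>p. fst p \<noteq> []) w1)"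
          have ms: "mset w2 = filter_mset (\<lambda>p. fst p \<noteq> []) (mset w1)" by (simp add: w2_def)
          have "admissible_row n m q p" if "p \<in> set w2" for p
          proof -
            have p: "p \<in> set w1" "fst p \<noteq> []" using that by (auto simp: w2_def)
            show ?thesis
            proof (cases "p \<in> set (xs @ ys @ zs)")
              case False
              then have "p \<in> {(Y, T), (A', B'), (C', D')}" using p by (auto simp: w1_def)
              then show ?thesis using \<open>length C < n\<close> BD that p len
                  \<open>length Y = Suc (length C)\<close> \<open>length T = length Y\<close> \<open>length B' = length A'\<close>
                  \<open>length D' = length C'\<close> \<open>Suc (length A' + length C') = length A\<close>
                  \<open>set Y \<union> set A' \<union> set C' \<subseteq> set A \<union> set C\<close>
                by (auto simp: admissible_row_def Suc_le_eq)
            qed (use oks in auto)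
          qed
          then have valid2: "valid_word n m q w2"
            by (auto simp: valid_word_def w2_def)
          have "\<mu>1 w2 = (\<Sum>p\<in>#mset w2. defect n (length (fst p)))"
            by (simp add: \<mu>1_def sum_mset_sum_list[symmetric])
          also have "\<dots> = (\<Sum>p\<leftarrow>filter (\<lambda>p. fst p \<noteq> []) w1. defect n (length (fst p)))"
            unfolding ms mset_filter[symmetric] mset_map[symmetric] sum_mset_sum_list ..
          also have "\<dots> = \<mu>1 w1"
            unfolding \<mu>1_def by (intro sum_list_map_filter) auto
          also have "\<dots> < \<mu>1 w"
            using defect_less[OF len(4) \<open>length C < n\<close> that(5)] that(1) by (simp add: \<mu>1_def w1_def ws)
          finally have "word_fun g w2 \<in> V" using IH[OF valid2] \<mu>1 by simp
          also have "word_fun g w2 = (\<lambda>x. F x * bracket (g x) Y T * bracket (g x) A' B' * bracket (g x) C' D')"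
          proof
            fix x
            let ?b = "\<lambda>p. bracket (g x) (fst p) (snd p)"
            have "word_fun g w2 x = (\<Prod>p\<in>#mset w2. ?b p)"
              by (simp add: word_fun_def case_prod_unfold prod_mset_prod_list[symmetric])
            also have "\<dots> = (\<Prod>p\<leftarrow>filter (\<lambda>p. fst p \<noteq> []) w1. ?b p)"
              unfolding ms mset_filter[symmetric] mset_map[symmetric] prod_mset_prod_list ..
            also have "\<dots> = (\<Prod>p\<leftarrow>w1. ?b p)"
              by (induction w1) auto
            also have "\<dots> = F x * bracket (g x) Y T * bracket (g x) A' B' * bracket (g x) C' D'"
              unfolding w1_def by (simp add: F_def word_fun_def case_prod_unfold)
            finally show "word_fun g w2 x = F x * bracket (g x) Y T * bracket (g x) A' B' * bracket (g x) C' D'" .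
          qed
          finally show ?thesis .
        qed
        have "(\<lambda>x. F x * bracket (g x) A B * bracket (g x) C D) \<in> V"
        proof (cases "idx_ge A C")
          case False
          then obtain j where j: "j < length A" "A ! j < C ! j"
            using len by (auto simp: idx_ge_def not_le)
          show ?thesis
          proof (rule garnir_exchange[OF V len(1,2,4) sorted(1,3) j])
            fix A' C' assume h: "length A' = length A" "length C' = length C" "set A' \<union> set C' \<subseteq> set A \<union> set C"
              and s: "sum_list A' + sum_list C' = sum_list A + sum_list C" "sum_list A < sum_list A'"
            show "(\<lambda>x. F x * bracket (g x) A' B * bracket (g x) C' D) \<in> V"
              using h okAB okCD len(5) position_weight_exchange[OF s, of 0 "map fst xs" "map fst ys" "map fst zs"]
              by (intro in_V) (auto simp: admissible_row_def row_key_def \<mu>2_def ws)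
          qed (rule in_V_long)
        next
          case True
          then obtain j where j: "j < length B" "B ! j < D ! j"
            using viol len by (auto simp: idx_ge_def not_le)
          \<comment> \<open>The columns \<open>[0..<n]\<close> lie below every admissible \<open>B\<close>, so they cannot violate the order.\<close>
          have D: "set D \<subseteq> {n..<n + q}"
          proof (rule ccontr)
            assume "\<not> ?thesis"
            then have D: "D = [0..<n]" using okCD by (auto simp: admissible_row_def)
            then have "B ! j < j" "j < n" using j len by auto
            moreover have "B ! j \<in> set B" using j by simp
            ultimately show False using okAB by (auto simp: admissible_row_def)
          qed
          then have "row_key n (C, D) \<le> n" using len by (auto simp: row_key_def)
          then have B: "set B \<subseteq> {n..<n + q}" using okAB le n1
            by (auto simp: admissible_row_def row_key_def split: if_splits)
          have "(\<lambda>x. F x * bracket (\<lambda>b a. g x a b) B A * bracket (\<lambda>b a. g x a b) D C) \<in> V"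
          proof (rule garnir_exchange[OF V _ _ _ sorted(2,4) j])
            fix B' D' assume h: "length B' = length B" "length D' = length D" "set B' \<union> set D' \<subseteq> set B \<union> set D"
              and s: "sum_list B' + sum_list D' = sum_list B + sum_list D" "sum_list B < sum_list B'"
            have BD': "set B' \<subseteq> {n..<n + q}" "set D' \<subseteq> {n..<n + q}" using h B D by auto
            have "(\<lambda>x. F x * bracket (g x) A B' * bracket (g x) C D') \<in> V"
              using h okAB okCD len B D BD' position_weight_exchange[OF s, of 0 "map snd xs" "map snd ys" "map snd zs"]
              by (intro in_V) (auto simp: admissible_row_def row_key_def \<mu>2_def ws)
            then show "(\<lambda>x. F x * bracket (\<lambda>b a. g x a b) B' A * bracket (\<lambda>b a. g x a b) D' C) \<in> V"
              using h len by (simp add: bracket_transpose[of B'] bracket_transpose[of D'])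
          next
            fix T Y B' A' D' C'
            assume h: "length T = Suc (length D)" "length Y = length T" "length A' = length B'" "length C' = length D'"
              "Suc (length B' + length D') = length B"
              "set T \<union> set B' \<union> set D' \<subseteq> set B \<union> set D" "set Y \<union> set A' \<union> set C' \<subseteq> set A \<union> set C"
            have "(\<lambda>x. F x * bracket (g x) Y T * bracket (g x) A' B' * bracket (g x) C' D') \<in> V"
              by (rule in_V_long) (use h len in auto)
            then show "(\<lambda>x. F x * bracket (\<lambda>b a. g x a b) T Y * bracket (\<lambda>b a. g x a b) B' A' *
                bracket (\<lambda>b a. g x a b) D' C') \<in> V"
              using h len by (simp add: bracket_transpose[of T] bracket_transpose[of B'] bracket_transpose[of D'])
          qed (use len in auto)
          then show ?thesis
            using len by (simp add: bracket_transpose[of B] bracket_transpose[of D])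
        qed
        also have "(\<lambda>x. F x * bracket (g x) A B * bracket (g x) C D) = word_fun g w"
          by (simp add: fun_eq_iff F_def ws)
        finally show ?thesis .
      qed
      moreover obtain c where "\<And>x. word_fun g w0 x = c * word_fun g w x"
        using word_fun_sort_rows[OF len0, of g] unfolding w_def by blast
      then have "word_fun g w0 = (\<lambda>x. c * word_fun g w x)" by auto
      ultimately show ?thesis using subspace_mult_const[OF V] by metis
    qed
  qed
qed

section \<open>Straightening with maximal minors on one side\<close>

lemma idx_ge_map_add [simp]: "idx_ge (map ((+) n) A) (map ((+) n) B) \<longleftrightarrow> idx_ge A B"
  by (auto simp: idx_ge_def)

definition pair_idx :: "nat \<Rightarrow> nat \<Rightarrow> nat \<Rightarrow> nat list \<times> nat list \<Rightarrow> bool" where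
  "pair_idx n m q = (\<lambda>(A, B). \<exists>r\<in>{1..n}. A \<in> idx r m \<and> B \<in> idx r q)"

definition coded_word :: "nat \<Rightarrow> (nat list \<times> nat list) list \<Rightarrow> nat list list \<Rightarrow> (nat list \<times> nat list) list" where
  "coded_word n ps Is = map (\<lambda>(A, B). (A, map ((+) n) B)) ps @ map (\<lambda>I. (I, [0..<n])) Is"

lemma valid_word_decode:
  assumes "\<forall>p\<in>set w. admissible_row n m q p" "sorted (map (row_key n) w)"
  shows "\<exists>ps Is. w = coded_word n ps Is"
  using assms
proof (induction w)
  case Nil
  show ?case by (intro exI[of _ "[]"]) (simp add: coded_word_def)
next
  case (Cons p w)
  then obtain ps Is where w: "w = coded_word n ps Is" by auto
  obtain A B where p: "p = (A, B)" by (cases p)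
  have ok: "admissible_row n m q (A, B)" using Cons.prems p by simp
  show ?case
  proof (cases "set B \<subseteq> {n..}")
    case True
    then have "map ((+) n) (map (\<lambda>b. b - n) B) = B" by (auto simp: o_def intro!: map_idI)
    then show ?thesis
      by (intro exI[of _ "(A, map (\<lambda>b. b - n) B) # ps"] exI[of _ Is]) (simp add: coded_word_def w p)
  next
    case False
    then have B: "B = [0..<n]" using ok by (auto simp: admissible_row_def)
    have "ps = []"
    proof (cases ps)
      case (Cons p' ps')
      obtain C D where p': "p' = (C, D)" by (cases p')
      have "(C, map ((+) n) D) \<in> set w" by (simp add: w coded_word_def Cons p')
      then have "Suc n \<le> row_key n (C, map ((+) n) D)" "admissible_row n m q (C, map ((+) n) D)"
        using Cons.prems False by (auto simp: p row_key_def)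
      moreover have "row_key n (C, map ((+) n) D) = length C"
        by (auto simp: row_key_def)
      ultimately show ?thesis by (auto simp: admissible_row_def)
    qed simp
    then show ?thesis by (intro exI[of _ "[]"] exI[of _ "A # Is"]) (simp add: coded_word_def w p B)
  qed
qed

lemma mem_idx_iff: "I \<in> idx r k \<longleftrightarrow> length I = r \<and> sorted_wrt (<) I \<and> set I \<subseteq> {..<k}"
  by (simp add: idx_def)

text \<open>
  The span statement for products of factors \<open>p(A, B)\<close> and \<open>u(I)\<close>, with the encoding by coordinate
  covectors removed. Stated for arbitrary coordinate functions \<open>u\<close>, \<open>w\<close>, it also applies with
  \<open>U\<close> and \<open>W\<close> exchanged, and then covers the factors \<open>\<xi>(J)\<close>. In both applications \<open>V\<close> consists of
  the functions whose restriction to \<open>X\<close> lies in the span of the standard monomials.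
\<close>

theorem one_sided_straightening:
  fixes n :: nat and u :: "'x \<Rightarrow> nat \<Rightarrow> nat \<Rightarrow> 'k::field" and w :: "'x \<Rightarrow> nat \<Rightarrow> nat \<Rightarrow> 'k"
  defines "p \<equiv> \<lambda>x a b. \<Sum>k<n. u x a k * w x k b"
  assumes V: "fun_vs.subspace V" and n: "n \<ge> 1"
    and std: "\<And>ps Is. \<forall>P\<in>set ps. pair_idx n m q P \<Longrightarrow> set Is \<subseteq> idx n m \<Longrightarrow>
      sorted_wrt pair_ge ps \<Longrightarrow> sorted_wrt idx_ge Is \<Longrightarrow>
      \<forall>(A, B)\<in>set ps. \<forall>I\<in>set Is. idx_ge A I \<Longrightarrow>
      (\<lambda>x. word_fun p ps x * (\<Prod>I\<leftarrow>Is. bracket (u x) I [0..<n])) \<in> V"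
    and ps: "\<forall>P\<in>set ps. pair_idx n m q P" and Is: "set Is \<subseteq> idx n m"
  shows "(\<lambda>x. word_fun p ps x * (\<Prod>I\<leftarrow>Is. bracket (u x) I [0..<n])) \<in> V"
proof -
  \<comment> \<open>The pairing of \<open>straightening\<close>: coordinate covectors for the labels below \<open>n\<close>, then the given covectors.\<close>
  define w' where "w' x k b = (if b < n then if b = k then 1 else 0 else w x k (b - n))" for x k b
  define g where "g x a b = (\<Sum>k<n. u x a k * w' x k b)" for x a b
  have g_p: "bracket (g x) A (map ((+) n) B) = bracket (p x) A B" if "length B = length A" for x A B
    using bracket_map[OF that, of "g x" id "(+) n"] that
    by (auto simp: g_def w'_def p_def intro: bracket_cong)
  have g_u: "bracket (g x) I [0..<n] = bracket (u x) I [0..<n]" if "length I = n" for x I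
  proof (rule bracket_cong)
    fix a b assume "b \<in> set [0..<n]"
    then have "g x a b = (\<Sum>k<n. u x a k * (if b = k then 1 else 0))"
      unfolding g_def w'_def by (intro sum.cong) simp_all
    also have "\<dots> = u x a b" using \<open>b \<in> set [0..<n]\<close> by (simp add: if_distrib[of "(*) _"] cong: if_cong)
    finally show "g x a b = u x a b" .
  qed (use that in simp)
  have code: "word_fun g (coded_word n qs Js) = (\<lambda>x. word_fun p qs x * (\<Prod>I\<leftarrow>Js. bracket (u x) I [0..<n]))"
    if "\<forall>(A, B)\<in>set qs. length B = length A" "\<forall>I\<in>set Js. length I = n" for qs Js
  proof
    fix x
    have "word_fun g (map (\<lambda>(A, B). (A, map ((+) n) B)) qs) x = word_fun p qs x"
      using that(1) by (induction qs) (auto simp: g_p)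
    moreover have "word_fun g (map (\<lambda>I. (I, [0..<n])) Js) x = (\<Prod>I\<leftarrow>Js. bracket (u x) I [0..<n])"
      using that(2) by (induction Js) (auto simp: g_u)
    ultimately show "word_fun g (coded_word n qs Js) x = word_fun p qs x * (\<Prod>I\<leftarrow>Js. bracket (u x) I [0..<n])"
      by (simp add: coded_word_def)
  qed
  define qs where "qs = sort_key (length \<circ> fst) ps"
  have qs: "\<forall>P\<in>set qs. pair_idx n m q P" using ps by (simp add: qs_def)
  have qs_p: "word_fun p qs x = word_fun p ps x" for x
    unfolding word_fun_def prod_mset_prod_list[symmetric] by (simp add: qs_def)
  have not_sub: "\<not> {0..<n} \<subseteq> {n..}" using n by (auto simp: subset_iff intro!: exI[of _ 0])
  have valid: "valid_word n m q (coded_word n qs Is)"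
  proof -
    have ok: "\<forall>P\<in>set (coded_word n qs Is). admissible_row n m q P"
      using qs Is n by (fastforce simp: coded_word_def admissible_row_def pair_idx_def mem_idx_iff)
    have k1: "map (row_key n) (map (\<lambda>(A, B). (A, map ((+) n) B)) qs) = map (length \<circ> fst) qs"
      by (auto simp: row_key_def)
    have "map (row_key n) (map (\<lambda>I. (I, [0..<n])) Is) = map (\<lambda>_. Suc n) Is"
      using not_sub by (auto simp: row_key_def)
    then have "map (row_key n) (coded_word n qs Is) = map (length \<circ> fst) qs @ map (\<lambda>_. Suc n) Is"
      using k1 by (simp add: coded_word_def)
    moreover have "sorted (map (length \<circ> fst) qs)" unfolding qs_def by simp
    moreover have "sorted (map (\<lambda>_. Suc n) Is)" by (induction Is) auto
    moreover have "length A \<le> n" if "(A, B) \<in> set qs" for A B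
      using qs that by (auto simp: pair_idx_def mem_idx_iff)
    ultimately have "sorted (map (row_key n) (coded_word n qs Is))"
      by (auto simp: sorted_append intro: le_SucI)
    with ok show ?thesis by (simp add: valid_word_def)
  qed
  have "word_fun g (coded_word n qs Is) \<in> V"
  proof (rule straightening[OF V _ _ valid])
    show "bracket (g x) A B = 0" if "n < length A" "length B = length A" for x A B
      unfolding g_def by (rule bracket_rank) (use that in auto)
    fix v assume v: "standard_word n m q v"
    then obtain ps Is where vc: "v = coded_word n ps Is"
      using valid_word_decode[of v n m q] by (auto simp: standard_word_def valid_word_def)
    have v_row: "admissible_row n m q (C, D) \<and> sorted_wrt (<) C \<and> sorted_wrt (<) D" if "(C, D) \<in> set v" for C D
      using v that by (auto simp: standard_word_def valid_word_def)
    have ok: "admissible_row n m q (A, map ((+) n) B)" "sorted_wrt (<) A" "sorted_wrt (<) B" if "(A, B) \<in> set ps" for A B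
    proof -
      have "(A, map ((+) n) B) \<in> set v" using that by (force simp: vc coded_word_def)
      from v_row[OF this] show "admissible_row n m q (A, map ((+) n) B)" "sorted_wrt (<) A" "sorted_wrt (<) B"
        by (auto simp: sorted_wrt_map)
    qed
    have okI: "admissible_row n m q (I, [0..<n])" "sorted_wrt (<) I" if "I \<in> set Is" for I
      using v_row[of I "[0..<n]"] that by (auto simp: vc coded_word_def)
    have p1: "\<forall>P\<in>set ps. pair_idx n m q P"
    proof safe
      fix A B assume AB: "(A, B) \<in> set ps"
      have "map ((+) n) B \<noteq> [0..<n]"
      proof
        assume *: "map ((+) n) B = [0..<n]"
        have "set (map ((+) n) B) \<subseteq> {n..}" by auto
        then show False using not_sub unfolding * by simp
      qed
      then show "pair_idx n m q (A, B)"
        using ok[OF AB] by (auto simp: admissible_row_def pair_idx_def mem_idx_iff)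
    qed
    have I1: "set Is \<subseteq> idx n m" using okI by (auto simp: admissible_row_def mem_idx_iff)
    have s: "sorted_wrt pair_ge (coded_word n ps Is)"
      using v unfolding standard_word_def vc by blast
    have "sorted_wrt pair_ge ps" "sorted_wrt idx_ge Is" "\<forall>(A, B)\<in>set ps. \<forall>I\<in>set Is. idx_ge A I"
      using s by (auto simp: coded_word_def sorted_wrt_append sorted_wrt_map pair_ge_def case_prod_unfold idx_ge_map_add
          elim!: sorted_wrt_mono_rel[rotated])
    then have "(\<lambda>x. word_fun p ps x * (\<Prod>I\<leftarrow>Is. bracket (u x) I [0..<n])) \<in> V"
      by (intro std p1 I1)
    then show "word_fun g v \<in> V"
      unfolding vc using p1 I1 by (subst code) (auto simp: pair_idx_def mem_idx_iff)
  qed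
  also have "word_fun g (coded_word n qs Is) = (\<lambda>x. word_fun p ps x * (\<Prod>I\<leftarrow>Is. bracket (u x) I [0..<n]))"
    using qs Is by (subst code) (auto simp: pair_idx_def mem_idx_iff qs_p)
  finally show ?thesis .
qed

section \<open>The standard monomials span\<close>

text \<open>
  The generators over an arbitrary commutative ring. At a point of \<open>X\<close> this is \<open>H_val\<close>; with
  monomials in \<open>t\<close> as coordinates it gives the polynomials used for independence. The argument
  \<open>w\<close> takes the column index first, so that \<open>u(I)\<close> and \<open>\<xi>(J)\<close> are treated alike.
\<close>

definition generator_value :: "nat \<Rightarrow> (nat \<Rightarrow> nat \<Rightarrow> 'k::comm_ring_1) \<Rightarrow> (nat \<Rightarrow> nat \<Rightarrow> 'k) \<Rightarrow> hindex \<Rightarrow> 'k" where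
  "generator_value n u w h = (case h of
      HP A B \<Rightarrow> bracket (\<lambda>a b. \<Sum>k<n. u a k * w b k) A B
    | HU I \<Rightarrow> bracket u I [0..<n]
    | HXi J \<Rightarrow> bracket w J [0..<n])"

abbreviation coord_u :: "'k mat \<times> 'k mat \<Rightarrow> nat \<Rightarrow> nat \<Rightarrow> 'k" where
  "coord_u x \<equiv> \<lambda>i k. fst x $$ (i, k)"

abbreviation coord_w :: "'k mat \<times> 'k mat \<Rightarrow> nat \<Rightarrow> nat \<Rightarrow> 'k" where
  "coord_w x \<equiv> \<lambda>j k. snd x $$ (k, j)"

lemma H_set_cases:
  assumes "h \<in> H_set n m q"
  obtains (HP) A B where "h = HP A B" "pair_idx n m q (A, B)"
  | (HU) I where "h = HU I" "I \<in> idx n m"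
  | (HXi) J where "h = HXi J" "J \<in> idx n q"
  using assms by (auto simp: H_set_def pair_idx_def)

lemma H_set_simps [simp]:
  "HP A B \<in> H_set n m q \<longleftrightarrow> pair_idx n m q (A, B)"
  "HU I \<in> H_set n m q \<longleftrightarrow> I \<in> idx n m"
  "HXi J \<in> H_set n m q \<longleftrightarrow> J \<in> idx n q"
  by (auto simp: H_set_def pair_idx_def)

lemma generator_value_cong:
  assumes "h \<in> H_set n m q" "\<And>i k. i < m \<Longrightarrow> k < n \<Longrightarrow> u i k = u' i k"
    "\<And>j k. j < q \<Longrightarrow> k < n \<Longrightarrow> w j k = w' j k"
  shows "generator_value n u w h = generator_value n u' w' h"
  using assms(1)
proof (cases rule: H_set_cases)
  case (HP A B)
  then have s: "set A \<subseteq> {..<m}" "set B \<subseteq> {..<q}" "length B = length A" by (auto simp: pair_idx_def mem_idx_iff)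
  have "bracket (\<lambda>a b. \<Sum>k<n. u a k * w b k) A B = bracket (\<lambda>a b. \<Sum>k<n. u' a k * w' b k) A B"
    using s assms by (intro bracket_cong sum.cong) (auto simp: subset_iff)
  then show ?thesis using HP by (simp add: generator_value_def)
next
  case (HU I)
  then have "bracket u I [0..<n] = bracket u' I [0..<n]"
    using assms by (intro bracket_cong) (auto simp: mem_idx_iff subset_iff)
  then show ?thesis using HU by (simp add: generator_value_def)
next
  case (HXi J)
  then have "bracket w J [0..<n] = bracket w' J [0..<n]"
    using assms by (intro bracket_cong) (auto simp: mem_idx_iff subset_iff)
  then show ?thesis using HXi by (simp add: generator_value_def)
qed

lemma H_val_eq_generator_value:
  assumes "x \<in> X_space n m q" "h \<in> H_set n m q"
  shows "H_val n h x = generator_value n (coord_u x) (coord_w x) h"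
proof -
  obtain U W where x: "x = (U, W)" "U \<in> carrier_mat m n" "W \<in> carrier_mat n q"
    using assms(1) by (auto simp: X_space_def)
  show ?thesis
    using assms(2)
  proof (cases rule: H_set_cases)
    case (HP A B)
    then have s: "set A \<subseteq> {..<m}" "set B \<subseteq> {..<q}" "length B = length A" by (auto simp: pair_idx_def mem_idx_iff)
    have "row U a \<bullet> col W b = (\<Sum>k<n. U $$ (a, k) * W $$ (k, b))" if "a < m" "b < q" for a b
      using x that by (auto simp: scalar_prod_def atLeast0LessThan)
    moreover have "A ! i < m" if "i < length A" for i using s that nth_mem[of i A] by blast
    moreover have "B ! i < q" if "i < length A" for i using s that nth_mem[of i B] by (metis lessThan_iff subsetD)
    ultimately show ?thesis
      unfolding HP x generator_value_def bracket_def hindex.case H_val.simps s(3)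
      by (intro arg_cong[where f = det] eq_matI) auto
  next
    case (HU I)
    then have "length I = n" by (simp add: mem_idx_iff)
    then show ?thesis
      unfolding HU x generator_value_def bracket_def hindex.case H_val.simps
      by (intro arg_cong[where f = det] eq_matI) auto
  next
    case (HXi J)
    then have J: "length J = n" by (simp add: mem_idx_iff)
    have "mat n n (\<lambda>(k, j). W $$ (k, J ! j)) = transpose_mat (mat n n (\<lambda>(i, j). W $$ ([0..<n] ! j, J ! i)))"
      by (rule eq_matI) auto
    then have "det (mat n n (\<lambda>(k, j). W $$ (k, J ! j))) = det (mat n n (\<lambda>(i, j). W $$ ([0..<n] ! j, J ! i)))"
      by (simp add: det_transpose[of _ n])
    then show ?thesis
      unfolding HXi x generator_value_def bracket_def hindex.case H_val.simps J by simp
  qed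
qed

lemma monomial_fun_eq:
  assumes "set hs \<subseteq> H_set n m q"
  shows "monomial_fun n m q hs = fun_on (X_space n m q) (\<lambda>x. \<Prod>h\<leftarrow>hs. generator_value n (coord_u x) (coord_w x) h)"
proof -
  have "(\<Prod>h\<leftarrow>hs. H_fun n m q h x) = (\<Prod>h\<leftarrow>hs. generator_value n (coord_u x) (coord_w x) h)"
    if "x \<in> X_space n m q" for x :: "'a mat \<times> 'a mat"
    using assms that by (intro arg_cong[where f = prod_list] map_cong)
      (auto simp: H_fun_def fun_on_def H_val_eq_generator_value subset_iff)
  then show ?thesis by (auto simp: monomial_fun_def fun_on_def fun_eq_iff)
qed

lemma monomial_fun_mset_cong:
  assumes "mset hs = mset hs'"
  shows "monomial_fun n m q hs = monomial_fun n m q hs'"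
  unfolding monomial_fun_def prod_mset_prod_list[symmetric] mset_map assms ..

lemma monomial_fun_append:
  "monomial_fun n m q (hs @ hs') = monomial_fun n m q hs * monomial_fun n m q hs'"
  by (auto simp: monomial_fun_def fun_on_def fun_eq_iff)

abbreviation standard_span :: "nat \<Rightarrow> nat \<Rightarrow> nat \<Rightarrow> ('k mat \<times> 'k mat \<Rightarrow> 'k::field) set" where
  "standard_span n m q \<equiv> fun_vs.span (monomial_fun n m q ` standard_seqs n m q)"

lemma subspace_fun_on:
  "fun_vs.subspace {f. fun_on X f \<in> fun_vs.span B}"
proof (rule fun_vs.subspaceI)
  show "0 \<in> {f. fun_on X f \<in> fun_vs.span B}"
    using fun_vs.span_zero[of B] by (simp add: fun_on_def zero_fun_def)
  fix f g assume fg: "f \<in> {f. fun_on X f \<in> fun_vs.span B}" "g \<in> {f. fun_on X f \<in> fun_vs.span B}"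
  have "fun_on X (f + g) = fun_on X f + fun_on X g" by (auto simp: fun_on_def)
  then show "f + g \<in> {f. fun_on X f \<in> fun_vs.span B}" using fg fun_vs.span_add by auto
next
  fix c f assume f: "f \<in> {f. fun_on X f \<in> fun_vs.span B}"
  have "fun_on X (fscale c f) = fscale c (fun_on X f)" by (auto simp: fun_on_def fscale_def)
  then show "fscale c f \<in> {f. fun_on X f \<in> fun_vs.span B}" using f fun_vs.span_scale by auto
qed

lemma generator_value_HP_list:
  "(\<Prod>h\<leftarrow>map (case_prod HP) ps. generator_value n u w h) = (\<Prod>(A, B)\<leftarrow>ps. bracket (\<lambda>a b. \<Sum>k<n. u a k * w b k) A B)"
  by (induction ps) (auto simp: generator_value_def)

lemma generator_value_HU_list: "(\<Prod>h\<leftarrow>map HU Is. generator_value n u w h) = (\<Prod>I\<leftarrow>Is. bracket u I [0..<n])"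
  and generator_value_HXi_list: "(\<Prod>h\<leftarrow>map HXi Js. generator_value n u w h) = (\<Prod>J\<leftarrow>Js. bracket w J [0..<n])"
  by (simp_all add: generator_value_def o_def)

lemma pairs_u_in_span:
  assumes n: "n \<ge> 1" and ps: "\<forall>P\<in>set ps. pair_idx n m q P" and Is: "set Is \<subseteq> idx n m"
  shows "(monomial_fun n m q (map (case_prod HP) ps @ map HU Is) :: 'k mat \<times> 'k mat \<Rightarrow> 'k::field)
    \<in> standard_span n m q"
proof -
  let ?X = "X_space n m q :: ('k mat \<times> 'k mat) set"
  let ?V = "{f. fun_on ?X f \<in> standard_span n m q}"
  let ?p = "\<lambda>x a b. \<Sum>k<n. coord_u x a k * snd x $$ (k, b)"
  let ?f = "\<lambda>ps Is x. word_fun ?p ps x * (\<Prod>I\<leftarrow>Is. bracket (coord_u x) I [0..<n])"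
  have eq: "fun_on ?X (?f ps Is) = monomial_fun n m q (map (case_prod HP) ps @ map HU Is)"
    if "\<forall>P\<in>set ps. pair_idx n m q P" "set Is \<subseteq> idx n m" for ps Is
    using that by (subst monomial_fun_eq)
      (force, simp only: map_append prod_list.append generator_value_HP_list generator_value_HU_list word_fun_def)
  have "?f ps Is \<in> ?V"
  proof (rule one_sided_straightening[OF subspace_fun_on n _ ps Is])
    fix ps Is assume h: "\<forall>P\<in>set ps. pair_idx n m q P" "set Is \<subseteq> idx n m"
      "sorted_wrt pair_ge ps" "sorted_wrt idx_ge Is" "\<forall>(A, B)\<in>set ps. \<forall>I\<in>set Is. idx_ge A I"
    have "sorted_wrt H_ge (map (case_prod HP) ps)" "sorted_wrt H_ge (map HU Is)"
      using h(3,4) by (auto simp: sorted_wrt_map pair_ge_def elim!: sorted_wrt_mono_rel[rotated])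
    then have "map (case_prod HP) ps @ map HU Is \<in> standard_seqs n m q"
      using h unfolding standard_seqs_def by (auto simp: sorted_wrt_append)
    then show "?f ps Is \<in> ?V"
      using eq[OF h(1,2)] by (auto intro: fun_vs.span_base)
  qed
  then show ?thesis using eq[OF ps Is] by simp
qed

lemma pairs_xi_in_span:
  assumes n: "n \<ge> 1" and ps: "\<forall>P\<in>set ps. pair_idx n m q P" and Js: "set Js \<subseteq> idx n q"
  shows "(monomial_fun n m q (map (case_prod HP) ps @ map HXi Js) :: 'k mat \<times> 'k mat \<Rightarrow> 'k::field)
    \<in> standard_span n m q"
proof -
  let ?X = "X_space n m q :: ('k mat \<times> 'k mat) set"
  let ?V = "{f. fun_on ?X f \<in> standard_span n m q}"
  let ?p = "\<lambda>x b a. \<Sum>k<n. coord_w x b k * fst x $$ (a, k)"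
  let ?f = "\<lambda>ps Js x. word_fun ?p ps x * (\<Prod>J\<leftarrow>Js. bracket (coord_w x) J [0..<n])"
  have swap: "pair_idx n q m (prod.swap P) \<longleftrightarrow> pair_idx n m q P" for P
    by (auto simp: pair_idx_def split: prod.splits)
  have eq: "fun_on ?X (?f ps Js) = monomial_fun n m q (map (case_prod HP) (map prod.swap ps) @ map HXi Js)"
    if h: "\<forall>P\<in>set ps. pair_idx n q m P" "set Js \<subseteq> idx n q" for ps Js
  proof -
    have "word_fun ?p ps x = (\<Prod>(A, B)\<leftarrow>map prod.swap ps. bracket (\<lambda>a b. \<Sum>k<n. coord_u x a k * coord_w x b k) A B)"
      for x :: "'k mat \<times> 'k mat"
      using h(1)
    proof (induction ps)
      case (Cons P ps)
      obtain B A where P: "P = (B, A)" by (cases P)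
      then have "length A = length B" using Cons.prems by (auto simp: pair_idx_def mem_idx_iff)
      then show ?case using Cons by (simp add: P bracket_transpose[of A B] mult.commute)
    qed simp
    moreover have "set (map (case_prod HP) (map prod.swap ps) @ map HXi Js) \<subseteq> H_set n m q"
      using h swap by (force simp: pair_idx_def)
    ultimately show ?thesis
      by (subst monomial_fun_eq) (simp_all only: map_append prod_list.append generator_value_HP_list generator_value_HXi_list)
  qed
  have ps': "\<forall>P\<in>set (map prod.swap ps). pair_idx n q m P" using ps by (auto simp: pair_idx_def)
  have "?f (map prod.swap ps) Js \<in> ?V"
  proof (rule one_sided_straightening[OF subspace_fun_on n _ ps' Js])
    fix ps Js assume h: "\<forall>P\<in>set ps. pair_idx n q m P" "set Js \<subseteq> idx n q"
      "sorted_wrt pair_ge ps" "sorted_wrt idx_ge Js" "\<forall>(A, B)\<in>set ps. \<forall>I\<in>set Js. idx_ge A I"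
    have "sorted_wrt H_ge (map (case_prod HP) (map prod.swap ps))" "sorted_wrt H_ge (map HXi Js)"
      using h(3,4) by (auto simp: sorted_wrt_map pair_ge_def elim!: sorted_wrt_mono_rel[rotated])
    moreover have "set (map (case_prod HP) (map prod.swap ps) @ map HXi Js) \<subseteq> H_set n m q"
      using h(1,2) by (force simp: pair_idx_def)
    moreover have "\<forall>h\<in>set (map (case_prod HP) (map prod.swap ps)). \<forall>h'\<in>set (map HXi Js). H_ge h h'"
      using h(5) by auto
    ultimately have "map (case_prod HP) (map prod.swap ps) @ map HXi Js \<in> standard_seqs n m q"
      unfolding standard_seqs_def mem_Collect_eq sorted_wrt_append by blast
    then show "?f ps Js \<in> ?V"
      unfolding mem_Collect_eq eq[OF h(1,2)] by (intro fun_vs.span_base imageI)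
  qed
  then have "(monomial_fun n m q (map (case_prod HP) (map prod.swap (map prod.swap ps)) @ map HXi Js)
      :: 'k mat \<times> 'k mat \<Rightarrow> 'k) \<in> standard_span n m q"
    unfolding mem_Collect_eq eq[OF ps' Js] .
  moreover have "map prod.swap (map prod.swap ps) = ps" by (simp add: o_def)
  ultimately show ?thesis by (simp only:)
qed

lemma generator_value_HU_HXi:
  assumes "length I = n" "length J = n"
  shows "generator_value n u w (HU I) * generator_value n u w (HXi J) = generator_value n u w (HP I J)"
proof -
  let ?P = "mat n n (\<lambda>(i, k). u (I ! i) k)" and ?Q = "mat n n (\<lambda>(j, k). w (J ! j) k)"
  have "mat n n (\<lambda>(i, j). \<Sum>k<n. u (I ! i) k * w (J ! j) k) = ?P * transpose_mat ?Q"
    by (rule eq_matI) (auto simp: scalar_prod_def atLeast0LessThan)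
  then have "det (mat n n (\<lambda>(i, j). \<Sum>k<n. u (I ! i) k * w (J ! j) k)) = det ?P * det ?Q"
    by (simp add: det_mult[of _ n] det_transpose[of _ n])
  moreover have "bracket u I [0..<n] = det ?P" "bracket w J [0..<n] = det ?Q"
    unfolding bracket_def assms by (auto intro!: arg_cong[where f = det] eq_matI)
  ultimately show ?thesis
    by (simp add: generator_value_def) (simp add: bracket_def assms)
qed

text \<open>
  Each pair of factors \<open>u(I)\<close>, \<open>\<xi>(J)\<close> merges into \<open>p(I, J)\<close> until one kind is exhausted.
\<close>

lemma mixed_in_span:
  assumes n: "n \<ge> 1" and "\<forall>P\<in>set ps. pair_idx n m q P" "set Is \<subseteq> idx n m" "set Js \<subseteq> idx n q"
  shows "(monomial_fun n m q (map (case_prod HP) ps @ map HU Is @ map HXi Js) :: 'k mat \<times> 'k mat \<Rightarrow> 'k::field)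
    \<in> standard_span n m q"
  using assms(2-)
proof (induction Is arbitrary: ps Js)
  case Nil
  then show ?case using pairs_xi_in_span[OF n, of ps m q Js] by simp
next
  case (Cons I Is)
  show ?case
  proof (cases Js)
    case Nil
    then show ?thesis using pairs_u_in_span[OF n, of ps m q "I # Is"] Cons.prems by simp
  next
    case J: (Cons J Js')
    let ?hs = "map (case_prod HP) ps @ map HU (I # Is) @ map HXi Js"
    let ?hs' = "map (case_prod HP) ((I, J) # ps) @ map HU Is @ map HXi Js'"
    have IJ: "length I = n" "length J = n" "pair_idx n m q (I, J)"
      using Cons.prems n J by (auto simp: pair_idx_def mem_idx_iff)
    have "set ?hs \<subseteq> H_set n m q" "set ?hs' \<subseteq> H_set n m q"
      using Cons.prems IJ J by force+
    moreover have "(\<Prod>h\<leftarrow>?hs. generator_value n u w h) = (\<Prod>h\<leftarrow>?hs'. generator_value n u w h)"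
      for u w :: "nat \<Rightarrow> nat \<Rightarrow> 'k"
      using generator_value_HU_HXi[OF IJ(1,2), of u w, symmetric] by (simp add: J mult_ac)
    ultimately have "monomial_fun n m q ?hs = (monomial_fun n m q ?hs' :: 'k mat \<times> 'k mat \<Rightarrow> 'k)"
      by (simp only: monomial_fun_eq)
    then show ?thesis using Cons.IH[of "(I, J) # ps" Js'] Cons.prems IJ J by simp
  qed
qed

lemma monomials_in_span:
  assumes n: "n \<ge> 1" and hs: "set hs \<subseteq> H_set n m q"
  shows "(monomial_fun n m q hs :: 'k mat \<times> 'k mat \<Rightarrow> 'k::field) \<in> standard_span n m q"
proof -
  have "\<exists>ps Is Js. mset hs = mset (map (case_prod HP) ps @ map HU Is @ map HXi Js)"
  proof (induction hs)
    case Nil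
    show ?case by (intro exI[of _ "[]"]) simp
  next
    case (Cons h hs)
    then obtain ps Is Js where *: "mset hs = mset (map (case_prod HP) ps @ map HU Is @ map HXi Js)" by blast
    show ?case
    proof (cases h)
      case (HP A B)
      then show ?thesis using * by (intro exI[of _ "(A, B) # ps"] exI[of _ Is] exI[of _ Js]) simp
    next
      case (HU I)
      then show ?thesis using * by (intro exI[of _ ps] exI[of _ "I # Is"] exI[of _ Js]) simp
    next
      case (HXi J)
      then show ?thesis using * by (intro exI[of _ ps] exI[of _ Is] exI[of _ "J # Js"]) simp
    qed
  qed
  then obtain ps Is Js where *: "mset hs = mset (map (case_prod HP) ps @ map HU Is @ map HXi Js)" by blast
  then have "set (map (case_prod HP) ps @ map HU Is @ map HXi Js) \<subseteq> H_set n m q"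
    using hs mset_eq_setD by metis
  then have "\<forall>P\<in>set ps. pair_idx n m q P" "set Is \<subseteq> idx n m" "set Js \<subseteq> idx n q"
    by (auto simp: subset_iff)
  from mixed_in_span[OF n this] show ?thesis
    unfolding monomial_fun_mset_cong[OF *] .
qed

lemma standard_span_mult:
  fixes f g :: "'k mat \<times> 'k mat \<Rightarrow> 'k::field"
  assumes n: "n \<ge> 1" and f: "f \<in> standard_span n m q" and g: "g \<in> standard_span n m q"
  shows "f * g \<in> standard_span n m q"
proof -
  let ?B = "monomial_fun n m q ` standard_seqs n m q :: ('k mat \<times> 'k mat \<Rightarrow> 'k) set"
  have std: "set hs \<subseteq> H_set n m q" if "hs \<in> standard_seqs n m q" for hs
    using that by (simp add: standard_seqs_def)
  have sub: "fun_vs.subspace {f. f * g \<in> standard_span n m q}" for g :: "'k mat \<times> 'k mat \<Rightarrow> 'k"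
  proof (rule fun_vs.subspaceI)
    show "0 \<in> {f. f * g \<in> standard_span n m q}" by (simp add: fun_vs.span_zero)
    fix f f' assume "f \<in> {f. f * g \<in> standard_span n m q}" "f' \<in> {f. f * g \<in> standard_span n m q}"
    then show "f + f' \<in> {f. f * g \<in> standard_span n m q}"
      by (simp add: distrib_right fun_vs.span_add)
  next
    fix c f assume "f \<in> {f. f * g \<in> standard_span n m q}"
    moreover have "fscale c f * g = fscale c (f * g)" by (auto simp: fscale_def fun_eq_iff)
    ultimately show "fscale c f \<in> {f. f * g \<in> standard_span n m q}" by (simp add: fun_vs.span_scale)
  qed
  have base: "f * g \<in> standard_span n m q" if fg: "f \<in> ?B" "g \<in> ?B" for f g :: "'k mat \<times> 'k mat \<Rightarrow> 'k"
  proof -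
    obtain hs hs' where "hs \<in> standard_seqs n m q" "f = monomial_fun n m q hs"
      "hs' \<in> standard_seqs n m q" "g = monomial_fun n m q hs'"
      using fg by auto
    then show ?thesis
      using monomials_in_span[OF n, of "hs @ hs'" m q] std by (simp add: monomial_fun_append)
  qed
  have one: "f * g \<in> standard_span n m q" if "g \<in> ?B" for g
    using fun_vs.span_minimal[of ?B "{f. f * g \<in> standard_span n m q}"] base[OF _ that] sub f by blast
  have "g \<in> {g. g * f \<in> standard_span n m q}"
    using fun_vs.span_minimal[of ?B "{g. g * f \<in> standard_span n m q}"] one sub g
    by (metis (no_types, lifting) mem_Collect_eq mult.commute subsetD subsetI)
  then show ?thesis by (simp add: mult.commute)
qed

theorem standard_span_eq:
  assumes n: "n \<ge> 1"
  shows "standard_span n m q = (S_alg n m q :: ('k mat \<times> 'k mat \<Rightarrow> 'k::field) set)"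
proof
  let ?X = "X_space n m q :: ('k mat \<times> 'k mat) set"
  have S: "subalgebra ?X (S_alg n m q)" by (rule S_alg_subalgebra)
  have gen: "H_fun n m q h \<in> S_alg n m q" if "h \<in> H_set n m q" for h
    unfolding S_alg_def using that by (intro subsetD[OF hull_subset]) auto
  have mono: "monomial_fun n m q hs \<in> (S_alg n m q :: ('k mat \<times> 'k mat \<Rightarrow> 'k) set)"
    if "set hs \<subseteq> H_set n m q" for hs
    using that
  proof (induction hs)
    case Nil
    then show ?case using S by (simp add: monomial_fun_def subalgebra_def)
  next
    case (Cons h hs)
    have eq: "monomial_fun n m q (h # hs) = H_fun n m q h * (monomial_fun n m q hs :: 'k mat \<times> 'k mat \<Rightarrow> 'k)"
      by (auto simp: monomial_fun_def fun_on_def H_fun_def fun_eq_iff)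
    have "H_fun n m q h \<in> (S_alg n m q :: ('k mat \<times> 'k mat \<Rightarrow> 'k) set)"
      using Cons.prems by (intro gen) simp
    moreover have "monomial_fun n m q hs \<in> (S_alg n m q :: ('k mat \<times> 'k mat \<Rightarrow> 'k) set)"
      using Cons by simp
    ultimately show ?case unfolding eq using S unfolding subalgebra_def by blast
  qed
  show "standard_span n m q \<subseteq> (S_alg n m q :: ('k mat \<times> 'k mat \<Rightarrow> 'k) set)"
    using S mono by (intro fun_vs.span_minimal) (auto simp: subalgebra_def standard_seqs_def)
  show "(S_alg n m q :: ('k mat \<times> 'k mat \<Rightarrow> 'k) set) \<subseteq> standard_span n m q"
    unfolding S_alg_def
  proof (rule hull_minimal)
    have one_mono: "monomial_fun n m q [h] = H_fun n m q h" for h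
      by (auto simp: monomial_fun_def H_fun_def fun_on_def fun_eq_iff)
    show "H_fun n m q ` H_set n m q \<subseteq> standard_span n m q"
      using monomials_in_span[OF n, of "[_]" m q] unfolding one_mono by auto
    have "fun_on ?X f = f" if "f \<in> standard_span n m q" for f
    proof -
      have "fun_vs.subspace {f :: 'k mat \<times> 'k mat \<Rightarrow> 'k. fun_on ?X f = f}"
        by (auto simp: fun_vs.subspace_def fun_on_def fscale_def fun_eq_iff)
      then have "standard_span n m q \<subseteq> {f :: 'k mat \<times> 'k mat \<Rightarrow> 'k. fun_on ?X f = f}"
        by (intro fun_vs.span_minimal) (auto simp: monomial_fun_def fun_on_def)
      then show ?thesis using that by auto
    qed
    moreover have "fun_on ?X (\<lambda>_. 1) \<in> standard_span n m q"
      using monomials_in_span[OF n, of "[]" m q] by (simp add: monomial_fun_def)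
    ultimately show "subalgebra ?X (standard_span n m q)"
      unfolding subalgebra_def using standard_span_mult[OF n] fun_vs.subspace_span by blast
  qed
qed

section \<open>Leading terms of minors\<close>

text \<open>
  Over a field this says that the polynomial is monic of degree \<open>D\<close>; the coefficient form
  is the one that passes through sums.
\<close>

definition monic_deg :: "'k::comm_ring_1 poly \<Rightarrow> nat \<Rightarrow> bool" where
  "monic_deg P D \<longleftrightarrow> coeff P D = 1 \<and> (\<forall>d>D. coeff P d = 0)"

lemma monic_deg_iff: "monic_deg (P :: 'k::field poly) D \<longleftrightarrow> degree P = D \<and> lead_coeff P = 1"
proof
  assume P: "monic_deg P D"
  then have "degree P \<le> D" by (intro degree_le) (auto simp: monic_deg_def)
  moreover have "D \<le> degree P" using P by (intro le_degree) (auto simp: monic_deg_def)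
  ultimately show "degree P = D \<and> lead_coeff P = 1" using P by (auto simp: monic_deg_def)
qed (auto simp: monic_deg_def coeff_eq_0)

lemma monic_deg_1: "monic_deg 1 0"
  by (simp add: monic_deg_def)

lemma monic_deg_mult:
  assumes "monic_deg (P :: 'k::field poly) D" "monic_deg Q E"
  shows "monic_deg (P * Q) (D + E)"
proof -
  have "P \<noteq> 0" "Q \<noteq> 0" using assms by (auto simp: monic_deg_def)
  then show ?thesis using assms coeff_mult_degree_sum[of P Q]
    by (auto simp: monic_deg_iff degree_mult_eq)
qed

lemma coeff_det_monom:
  "coeff (det (mat r r (\<lambda>(i, j). monom 1 (c i j) :: 'k::field poly))) d =
    (\<Sum>p | p permutes {0..<r}. if (\<Sum>i = 0..<r. c i (p i)) = d then signof p else 0)"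
proof -
  have lt: "p i < r" if "p permutes {0..<r}" "i < r" for p i
    using permutes_in_image[OF that(1), of i] that(2) by simp
  have pm: "(\<Prod>i\<in>I. monom (1 :: 'k) (h i)) = monom 1 (\<Sum>i\<in>I. h i)" if "finite I" for h :: "nat \<Rightarrow> nat" and I
    using that by (induction I rule: finite_induct) (simp_all add: mult_monom)
  have "det (mat r r (\<lambda>(i, j). monom (1 :: 'k) (c i j))) =
    (\<Sum>p | p permutes {0..<r}. signof p * (\<Prod>i = 0..<r. monom 1 (c i (p i))))"
    unfolding det_def by (auto intro!: sum.cong prod.cong simp: lt)
  also have "\<dots> = (\<Sum>p | p permutes {0..<r}. signof p * monom 1 (\<Sum>i = 0..<r. c i (p i)))"
    by (simp add: pm)
  finally show ?thesis
    by (auto simp: coeff_sum sign_def intro!: sum.cong)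
qed

lemma coeff_det_monom_zero:
  assumes "\<And>p. p permutes {0..<r} \<Longrightarrow> (\<Sum>i = 0..<r. c i (p i)) < D" "D \<le> d"
  shows "coeff (det (mat r r (\<lambda>(i, j). monom 1 (c i j) :: 'k::field poly))) d = 0"
  unfolding coeff_det_monom using assms by (intro sum.neutral) fastforce

lemma monic_deg_det_monom:
  assumes "\<And>p. p permutes {0..<r} \<Longrightarrow> p \<noteq> id \<Longrightarrow> (\<Sum>i = 0..<r. c i (p i)) < (\<Sum>i = 0..<r. c i i)"
  shows "monic_deg (det (mat r r (\<lambda>(i, j). monom 1 (c i j) :: 'k::field poly))) (\<Sum>i = 0..<r. c i i)"
proof -
  let ?D = "\<Sum>i = 0..<r. c i i"
  have "(\<Sum>p | p permutes {0..<r}. if (\<Sum>i = 0..<r. c i (p i)) = d then signof p else 0) =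
    (if ?D = d then (1 :: 'k) else 0)" if "?D \<le> d" for d
  proof -
    have "(\<Sum>p | p permutes {0..<r}. if (\<Sum>i = 0..<r. c i (p i)) = d then (signof p :: 'k) else 0) =
      (\<Sum>p | p permutes {0..<r}. if p = id then (if ?D = d then 1 else 0) else 0)"
      using assms that by (intro sum.cong) (fastforce simp: sign_id)+
    then show ?thesis by (simp add: finite_permutations permutes_id)
  qed
  then show ?thesis unfolding monic_deg_def coeff_det_monom by auto
qed

text \<open>
  The code orders the coordinates: columns with small index \<open>k\<close> first, within a column small
  \<open>i\<close> first, larger codes being more significant. Side \<open>s = 0\<close> is \<open>U\<close>, side \<open>s = 1\<close> is
  \<open>W\<close>. The coordinate with code \<open>c\<close> will be replaced by \<open>t ^ (M ^ c)\<close>.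
\<close>

definition cell_code :: "nat \<Rightarrow> nat \<Rightarrow> nat \<Rightarrow> nat \<Rightarrow> nat \<Rightarrow> nat" where
  "cell_code N n s i k = (s * (n + 1) + (n - k)) * (N + 1) + (N - i)"

lemma cell_code_inj:
  assumes "cell_code N n s i k = cell_code N n s' i' k'" "k < n" "k' < n" "i < N" "i' < N"
  shows "s = s' \<and> i = i' \<and> k = k'"
proof -
  have 1: "N - i < N + 1" "N - i' < N + 1" by auto
  have divmod: "(a * b + c) mod b = c" "(a * b + c) div b = a" if "c < b" for a b c :: nat
    using that by simp_all
  have "cell_code N n s i k mod (N + 1) = N - i" "cell_code N n s' i' k' mod (N + 1) = N - i'"
    unfolding cell_code_def using 1 by (simp_all only: divmod)
  then have i: "i = i'" using assms by simp
  have "cell_code N n s i k div (N + 1) = s * (n + 1) + (n - k)"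
    "cell_code N n s' i' k' div (N + 1) = s' * (n + 1) + (n - k')"
    unfolding cell_code_def using 1 by (simp_all only: divmod)
  then have e: "s * (n + 1) + (n - k) = s' * (n + 1) + (n - k')" using assms(1) by simp
  have 2: "n - k < n + 1" "n - k' < n + 1" by auto
  have "(s * (n + 1) + (n - k)) div (n + 1) = s" "(s' * (n + 1) + (n - k')) div (n + 1) = s'"
    using 2 by (simp_all only: divmod)
  then have "s = s'" using e by simp
  then show ?thesis using e i assms by simp
qed

lemma cell_code_less:
  assumes "k < k' \<and> k' \<le> n \<or> k = k' \<and> i < i' \<and> i' \<le> N"
  shows "cell_code N n s i' k' < cell_code N n s i k"
proof (cases "k < k'")
  case True
  then have "Suc (n - k') \<le> n - k" using assms by auto
  then have "Suc (s * (n + 1) + (n - k')) \<le> s * (n + 1) + (n - k)" by simp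
  then have "Suc (s * (n + 1) + (n - k')) * (N + 1) \<le> (s * (n + 1) + (n - k)) * (N + 1)"
    by (rule mult_le_mono1)
  moreover have "N - i' < N + 1" by simp
  ultimately show ?thesis unfolding cell_code_def mult_Suc by linarith
qed (use assms in \<open>auto simp: cell_code_def\<close>)

text \<open>
  At the first position \<open>j\<close> with \<open>f j \<noteq> j\<close> the diagonal uses the coordinate \<open>(a\<^sub>j, j)\<close>, which is more
  significant than every coordinate that \<open>f\<close> uses from there on. There are fewer than \<open>M\<close> of
  those, so the single power of \<open>M\<close> on the diagonal outweighs their sum.
\<close>

lemma diagonal_dominates:
  assumes A: "sorted_wrt (<) A" "set A \<subseteq> {..<N}" "length A = r" and M: "r < M"
    and f: "\<And>i. i < r \<Longrightarrow> f i < n" "inj_on f {0..<r}" "\<exists>i<r. f i \<noteq> i"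
  shows "(\<Sum>i = 0..<r. M ^ cell_code N n s (A ! i) (f i)) < (\<Sum>i = 0..<r. M ^ cell_code N n s (A ! i) i)"
proof -
  let ?e = "\<lambda>a k. M ^ cell_code N n s a k"
  define j where "j = (LEAST i. i < r \<and> f i \<noteq> i)"
  have j: "j < r" "f j \<noteq> j" using LeastI_ex[OF f(3)] unfolding j_def by auto
  have before: "f i = i" if "i < j" for i
    using not_less_Least[of i "\<lambda>i. i < r \<and> f i \<noteq> i"] that j(1) unfolding j_def by auto
  have step: "M * ?e (A ! i) (f i) \<le> ?e (A ! j) j" if i: "j \<le> i" "i < r" for i
  proof -
    have "\<not> f i < j"
    proof
      assume "f i < j"
      then have "f (f i) = f i" "f i < r" using before j by auto
      then have "f i = i" using f(2) i by (auto simp: inj_on_def)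
      then show False using \<open>f i < j\<close> i by simp
    qed
    moreover have "A ! j < A ! i" if "f i = j"
    proof -
      have "j < i" using i that j by (cases "i = j") auto
      then show ?thesis using A i by (auto simp: sorted_wrt_iff_nth_less)
    qed
    moreover have "A ! i < N" using A(2,3) i nth_mem[of i A] by blast
    ultimately have "cell_code N n s (A ! i) (f i) < cell_code N n s (A ! j) j"
      using f(1)[of i] i by (intro cell_code_less) (cases "f i = j"; auto)
    then have "Suc (cell_code N n s (A ! i) (f i)) \<le> cell_code N n s (A ! j) j" by simp
    then have "M ^ Suc (cell_code N n s (A ! i) (f i)) \<le> ?e (A ! j) j"
      using M by (intro power_increasing) auto
    then show ?thesis by simp
  qed
  have "M * (\<Sum>i = j..<r. ?e (A ! i) (f i)) = (\<Sum>i = j..<r. M * ?e (A ! i) (f i))"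
    by (rule sum_distrib_left)
  also have "\<dots> \<le> card {j..<r} * ?e (A ! j) j"
    using sum_bounded_above[of "{j..<r}" "\<lambda>i. M * ?e (A ! i) (f i)" "?e (A ! j) j"] step by simp
  also have "\<dots> < M * ?e (A ! j) j" using M by (intro mult_strict_right_mono) auto
  finally have "(\<Sum>i = j..<r. ?e (A ! i) (f i)) < ?e (A ! j) j" by simp
  also have "\<dots> \<le> (\<Sum>i = j..<r. ?e (A ! i) i)" using j by (intro member_le_sum) auto
  finally have "(\<Sum>i = j..<r. ?e (A ! i) (f i)) < (\<Sum>i = j..<r. ?e (A ! i) i)" .
  moreover have "(\<Sum>i = 0..<j. ?e (A ! i) (f i)) = (\<Sum>i = 0..<j. ?e (A ! i) i)"
    by (rule sum.cong) (auto simp: before)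
  ultimately show ?thesis
    using sum.atLeastLessThan_concat[of 0 j r "\<lambda>i. ?e (A ! i) (f i)"]
      sum.atLeastLessThan_concat[of 0 j r "\<lambda>i. ?e (A ! i) i"] j by simp
qed

definition row_degree :: "nat \<Rightarrow> nat \<Rightarrow> nat \<Rightarrow> nat \<Rightarrow> nat list \<Rightarrow> nat" where
  "row_degree M N n s A = (\<Sum>i = 0..<length A. M ^ cell_code N n s (A ! i) i)"

definition cell_monom :: "nat \<Rightarrow> nat \<Rightarrow> nat \<Rightarrow> nat \<Rightarrow> nat \<Rightarrow> nat \<Rightarrow> 'k::field poly" where
  "cell_monom M N n s a k = monom 1 (M ^ cell_code N n s a k)"

lemma permutes_neq_id:
  assumes "p permutes {0..<r}" "p \<noteq> id"
  shows "\<exists>i<r. p i \<noteq> i"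
  using assms by (metis atLeastLessThan_iff eq_id_iff le0 permutes_not_in)

lemma monic_deg_maximal_minor:
  assumes A: "sorted_wrt (<) A" "set A \<subseteq> {..<N}" "length A = n" and M: "n < M"
  shows "monic_deg (bracket (cell_monom M N n s :: _ \<Rightarrow> _ \<Rightarrow> 'k::field poly) A [0..<n]) (row_degree M N n s A)"
proof -
  have "bracket (cell_monom M N n s :: _ \<Rightarrow> _ \<Rightarrow> 'k::field poly) A [0..<n] =
    det (mat n n (\<lambda>(i, j). monom 1 (M ^ cell_code N n s (A ! i) j)))"
    unfolding bracket_def cell_monom_def A(3) by (intro arg_cong[where f = det] eq_matI) auto
  also have "monic_deg \<dots> (\<Sum>i = 0..<n. M ^ cell_code N n s (A ! i) i)"
  proof (rule monic_deg_det_monom)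
    fix p assume p: "p permutes {0..<n}" "p \<noteq> id"
    show "(\<Sum>i = 0..<n. M ^ cell_code N n s (A ! i) (p i)) < (\<Sum>i = 0..<n. M ^ cell_code N n s (A ! i) i)"
    proof (rule diagonal_dominates[OF A M])
      show "p i < n" if "i < n" for i using permutes_in_image[OF p(1), of i] that by simp
      show "inj_on p {0..<n}" using permutes_inj[OF p(1)] by (rule inj_on_subset) auto
      show "\<exists>i<n. p i \<noteq> i" by (rule permutes_neq_id[OF p])
    qed
  qed
  finally show ?thesis unfolding row_degree_def A(3) .
qed

text \<open>
  In the Cauchy-Binet expansion the term of an injective \<open>f\<close> and a permutation \<open>p\<close> has the exponent
  of \<open>f\<close> on the side of \<open>A\<close> and that of \<open>f \<circ> p\<^sup>-\<^sup>1\<close> on the side of \<open>B\<close>. Both are largest on the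
  diagonal, and only the identity reaches the maximum on both sides.
\<close>

lemma monic_deg_pairing_minor:
  assumes A: "sorted_wrt (<) A" "set A \<subseteq> {..<N}" "length A = r"
    and B: "sorted_wrt (<) B" "set B \<subseteq> {..<N}" "length B = r" and r: "r \<le> n" and M: "n < M"
  shows "monic_deg (bracket (\<lambda>a b. \<Sum>k<n. cell_monom M N n s a k * cell_monom M N n s' b k :: 'k::field poly) A B)
    (row_degree M N n s A + row_degree M N n s' B)"
proof -
  let ?e = "\<lambda>s a k. M ^ cell_code N n s a k"
  let ?D = "row_degree M N n s A + row_degree M N n s' B"
  let ?\<Delta> = "\<lambda>f. det (mat r r (\<lambda>(i, j). cell_monom M N n s (A ! i) (f i) * cell_monom M N n s' (B ! j) (f i) :: 'k poly))"
  let ?c = "\<lambda>f i j. ?e s (A ! i) (f i) + ?e s' (B ! j) (f i)"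
  let ?F = "{0..<r} \<rightarrow>\<^sub>E {..<n}"
  define f0 where "f0 = restrict id {0..<r}"
  have M': "r < M" using r M by simp
  have \<Delta>: "?\<Delta> f = det (mat r r (\<lambda>(i, j). monom 1 (?c f i j)))" for f
    by (intro arg_cong[where f = det] eq_matI) (auto simp: cell_monom_def mult_monom)
  have split: "(\<Sum>i = 0..<r. ?c f i (p i)) =
      (\<Sum>i = 0..<r. ?e s (A ! i) (f i)) + (\<Sum>j = 0..<r. ?e s' (B ! j) ((f \<circ> Hilbert_Choice.inv p) j))"
    if p: "p permutes {0..<r}" for f p
  proof -
    have "(\<Sum>j = 0..<r. ?e s' (B ! j) ((f \<circ> Hilbert_Choice.inv p) j)) = (\<Sum>i = 0..<r. ?e s' (B ! p i) ((f \<circ> Hilbert_Choice.inv p) (p i)))"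
      using sum.permute[OF p, of "\<lambda>j. ?e s' (B ! j) ((f \<circ> Hilbert_Choice.inv p) j)"] by (simp add: o_def)
    then show ?thesis by (simp add: sum.distrib permutes_inverses(2)[OF p])
  qed
  have le: "(\<Sum>i = 0..<r. ?e s (A ! i) (f i)) \<le> (\<Sum>i = 0..<r. ?e s (A ! i) i)"
    if "sorted_wrt (<) A" "set A \<subseteq> {..<N}" "length A = r" "\<And>i. i < r \<Longrightarrow> f i < n" "inj_on f {0..<r}" for s A f
  proof (cases "\<exists>i<r. f i \<noteq> i")
    case True
    then show ?thesis using diagonal_dominates[OF that(1-3) M' that(4,5)] by (simp add: less_imp_le)
  qed simp
  have comp: "inj_on (f \<circ> Hilbert_Choice.inv p) {0..<r}" "\<And>i. i < r \<Longrightarrow> (f \<circ> Hilbert_Choice.inv p) i < n"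
    if "p permutes {0..<r}" "inj_on f {0..<r}" "\<And>i. i < r \<Longrightarrow> f i < n" for f :: "nat \<Rightarrow> nat" and p
  proof -
    have ip: "Hilbert_Choice.inv p permutes {0..<r}" by (rule permutes_inv[OF that(1)])
    show "inj_on (f \<circ> Hilbert_Choice.inv p) {0..<r}"
      using that(2) permutes_image[OF ip] permutes_inj[OF ip]
      by (intro comp_inj_on) (auto intro: inj_on_subset)
    show "(f \<circ> Hilbert_Choice.inv p) i < n" if "i < r" for i
      using permutes_in_image[OF ip, of i] that \<open>\<And>i. i < r \<Longrightarrow> f i < n\<close> by simp
  qed
  have D: "?D = (\<Sum>i = 0..<r. ?e s (A ! i) i) + (\<Sum>i = 0..<r. ?e s' (B ! i) i)"
    unfolding row_degree_def using A B by simp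
  have other: "coeff (?\<Delta> f) d = 0" if f: "f \<in> ?F" "f \<noteq> f0" and d: "?D \<le> d" for f d
  proof (cases "inj_on f {0..<r}")
    case True
    have fn: "f i < n" if "i < r" for i using f(1) that by auto
    have ne: "\<exists>i<r. f i \<noteq> i"
    proof (rule ccontr)
      assume "\<not> ?thesis"
      then have "f = f0" using f(1) by (auto simp: f0_def fun_eq_iff PiE_def extensional_def)
      then show False using f(2) by simp
    qed
    show ?thesis unfolding \<Delta>
    proof (rule coeff_det_monom_zero[OF _ d])
      fix p assume p: "p permutes {0..<r}"
      show "(\<Sum>i = 0..<r. ?c f i (p i)) < ?D"
        unfolding split[OF p] D
        by (intro add_less_le_mono diagonal_dominates[OF A M' fn True ne] le[OF B] comp[OF p True fn])
    qed
  next
    case False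
    then show ?thesis
      using bracket_rank_term[where f = f and A = A and B = B and l = r and u = "cell_monom M N n s"
        and w = "\<lambda>k b. cell_monom M N n s' b k" and 'k = "'k poly"] A B by simp
  qed
  have main: "monic_deg (?\<Delta> f0) ?D"
  proof -
    have e: "(\<Sum>i = 0..<r. ?c f0 i i) = ?D" unfolding D by (simp add: f0_def sum.distrib)
    have "monic_deg (?\<Delta> f0) (\<Sum>i = 0..<r. ?c f0 i i)" unfolding \<Delta>
    proof (rule monic_deg_det_monom)
      fix p assume p: "p permutes {0..<r}" "p \<noteq> id"
      have ip: "Hilbert_Choice.inv p permutes {0..<r}" by (rule permutes_inv[OF p(1)])
      have "Hilbert_Choice.inv p \<noteq> id" using p by (metis inv_id permutes_inv_inv)
      then obtain i where "i < r" "Hilbert_Choice.inv p i \<noteq> i" using permutes_neq_id[OF ip] by blast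
      moreover have lt: "Hilbert_Choice.inv p i < r" if "i < r" for i using permutes_in_image[OF ip, of i] that by simp
      ultimately have "\<exists>i<r. (f0 \<circ> Hilbert_Choice.inv p) i \<noteq> i" by (auto simp: f0_def)
      moreover have f0: "inj_on f0 {0..<r}" "\<And>i. i < r \<Longrightarrow> f0 i < n" using r by (auto simp: f0_def inj_on_def)
      ultimately have "(\<Sum>j = 0..<r. ?e s' (B ! j) ((f0 \<circ> Hilbert_Choice.inv p) j)) < (\<Sum>j = 0..<r. ?e s' (B ! j) j)"
        by (intro diagonal_dominates[OF B M'] comp[OF p(1) f0])
      then show "(\<Sum>i = 0..<r. ?c f0 i (p i)) < (\<Sum>i = 0..<r. ?c f0 i i)"
        unfolding split[OF p(1)] e D by (simp add: f0_def)
    qed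
    then show ?thesis unfolding e .
  qed
  have fin: "finite ?F" by (intro finite_PiE) auto
  have f0F: "f0 \<in> ?F" using r by (auto simp: f0_def)
  have "bracket (\<lambda>a b. \<Sum>k<n. cell_monom M N n s a k * cell_monom M N n s' b k :: 'k poly) A B = (\<Sum>f\<in>?F. ?\<Delta> f)"
    using bracket_sum_rows[of "{..<n}" B A "\<lambda>k a b. cell_monom M N n s a k * cell_monom M N n s' b k"] A B by simp
  also have "\<dots> = ?\<Delta> f0 + (\<Sum>f\<in>?F - {f0}. ?\<Delta> f)"
    by (rule sum.remove[OF fin f0F])
  finally show ?thesis
    using main other by (auto simp: monic_deg_def coeff_sum)
qed

lemma sum_mset_powers:
  assumes "set_mset X \<subseteq> {..<b}"
  shows "(\<Sum>c\<in>#X. (M::nat) ^ c) = (\<Sum>c<b. count X c * M ^ c)"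
  using assms
proof (induction X)
  case (add x X)
  have "(\<Sum>c<b. count (add_mset x X) c * M ^ c) = (\<Sum>c<b. count X c * M ^ c + (if x = c then M ^ c else 0))"
    by (intro sum.cong) auto
  also have "\<dots> = (\<Sum>c<b. count X c * M ^ c) + M ^ x"
    using add.prems by (simp add: sum.distrib)
  finally show ?case using add by simp
qed simp

lemma digits_unique:
  fixes c d :: "nat \<Rightarrow> nat"
  assumes "(\<Sum>i<b. c i * M ^ i) = (\<Sum>i<b. d i * M ^ i)" "\<And>i. c i < M" "\<And>i. d i < M" "j < b"
  shows "c j = d j"
  using assms
proof (induction b arbitrary: c d j)
  case (Suc b)
  have s: "(\<Sum>i<Suc b. h i * M ^ i) = h 0 + M * (\<Sum>i<b. h (Suc i) * M ^ i)" for h :: "nat \<Rightarrow> nat"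
    unfolding sum.lessThan_Suc_shift by (simp add: sum_distrib_left algebra_simps)
  have eq: "c 0 + M * (\<Sum>i<b. c (Suc i) * M ^ i) = d 0 + M * (\<Sum>i<b. d (Suc i) * M ^ i)"
    using Suc.prems(1) unfolding s .
  have "c 0 = (c 0 + M * (\<Sum>i<b. c (Suc i) * M ^ i)) mod M" using Suc.prems(2) by simp
  also have "\<dots> = d 0" unfolding eq using Suc.prems(3) by simp
  finally have 0: "c 0 = d 0" .
  have "M > 0" using Suc.prems(2)[of 0] by simp
  then have "(\<Sum>i<b. c (Suc i) * M ^ i) = (\<Sum>i<b. d (Suc i) * M ^ i)" using eq 0 by simp
  then have "c (Suc i) = d (Suc i)" if "i < b" for i
    using Suc.IH[of "\<lambda>i. c (Suc i)" "\<lambda>i. d (Suc i)" i] Suc.prems(2,3) that by simp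
  then show ?case using 0 Suc.prems(4) by (cases j) auto
qed simp

text \<open>
  Uniqueness of base \<open>M\<close> digits, the multiplicities being the digits.
\<close>

lemma power_sum_inj:
  assumes "(\<Sum>c\<in>#X. (M::nat) ^ c) = (\<Sum>c\<in>#Y. M ^ c)" "size X < M" "size Y < M"
  shows "X = Y"
proof -
  define b where "b = Suc (Max (insert 0 (set_mset X \<union> set_mset Y)))"
  have b: "set_mset X \<subseteq> {..<b}" "set_mset Y \<subseteq> {..<b}" by (auto simp: b_def less_Suc_eq_le)
  have "count X c < M" "count Y c < M" for c
    using count_le_size[of X c] count_le_size[of Y c] assms by linarith+
  then have "count X c = count Y c" if "c < b" for c
    using digits_unique[where b = b and c = "count X" and d = "count Y" and M = M and j = c] assms(1) that
    by (simp add: sum_mset_powers[OF b(1)] sum_mset_powers[OF b(2)])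
  moreover have "count X c = count Y c" if "\<not> c < b" for c
    using b that by (metis count_inI lessThan_iff subsetD)
  ultimately show ?thesis by (intro multiset_eqI) blast
qed

lemma idx_ge_antisym: "idx_ge A B \<Longrightarrow> idx_ge B A \<Longrightarrow> A = B"
  by (auto simp: idx_ge_def intro!: nth_equalityI le_antisym)

lemma idx_ge_refl: "idx_ge A A"
  by (simp add: idx_ge_def)

definition cell_count :: "nat list list \<Rightarrow> nat \<Rightarrow> nat \<Rightarrow> nat" where
  "cell_count L a k = length (filter (\<lambda>A. k < length A \<and> A ! k = a) L)"

lemma cell_count_simps [simp]:
  "cell_count [] a k = 0"
  "cell_count (L @ L') a k = cell_count L a k + cell_count L' a k"
  "cell_count [A] a k = (if k < length A \<and> A ! k = a then 1 else 0)"
  by (simp_all add: cell_count_def)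

text \<open>
  The last row is the longest one and has the smallest entry in each column, so it can be read off
  from the contents of the columns; remove it and repeat.
\<close>

lemma tableau_determined:
  assumes "sorted_wrt idx_ge L" "sorted_wrt idx_ge L'" "[] \<notin> set L" "[] \<notin> set L'"
    "\<And>a k. cell_count L a k = cell_count L' a k"
  shows "L = L'"
  using assms
proof (induction L arbitrary: L' rule: rev_induct)
  case Nil
  show ?case
  proof (cases L')
    case (Cons A L'')
    then have "cell_count L' (A ! 0) 0 > 0" using Nil.prems(4) by (auto simp: cell_count_def)
    then show ?thesis using Nil.prems(5)[of "A ! 0" 0] by simp
  qed simp
next
  case (snoc Z L)
  have ge: "idx_ge A Z" if "A \<in> set L" for A using snoc.prems(1) that by (simp add: sorted_wrt_append)
  show ?case
  proof (cases L' rule: rev_cases)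
    case Nil
    have "Z \<noteq> []" using snoc.prems by auto
    then show ?thesis using snoc.prems(5)[of "Z ! 0" 0] Nil by simp
  next
    case (snoc K Z')
    have below: "idx_ge Y X" if L: "sorted_wrt idx_ge (K @ [X])" and c: "\<And>k. k < length Y \<Longrightarrow> cell_count (K @ [X]) (Y ! k) k > 0"
      for K X Y
    proof -
      have "k < length X \<and> X ! k \<le> Y ! k" if "k < length Y" for k
      proof -
        have "filter (\<lambda>A. k < length A \<and> A ! k = Y ! k) (K @ [X]) \<noteq> []"
          using c[OF that, unfolded cell_count_def length_greater_0_conv] .
        then obtain A where A: "A \<in> set (K @ [X])" "k < length A" "A ! k = Y ! k"
          unfolding filter_empty_conv by blast
        then have "idx_ge A X" using L by (auto simp: sorted_wrt_append idx_ge_refl)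
        then show ?thesis using A by (auto simp: idx_ge_def)
      qed
      then show ?thesis unfolding idx_ge_def by (meson le_less_linear order_less_irrefl)
    qed
    have "idx_ge Z Z'"
    proof (rule below)
      show "sorted_wrt idx_ge (K @ [Z'])" using \<open>sorted_wrt idx_ge L'\<close> snoc by simp
      show "cell_count (K @ [Z']) (Z ! k) k > 0" if "k < length Z" for k
        using that \<open>\<And>a k. cell_count (L @ [Z]) a k = cell_count L' a k\<close>[of "Z ! k" k] by (simp add: snoc split: if_splits)
    qed
    moreover have "idx_ge Z' Z"
    proof (rule below)
      show "sorted_wrt idx_ge (L @ [Z])" by fact
      show "cell_count (L @ [Z]) (Z' ! k) k > 0" if "k < length Z'" for k
        using that \<open>\<And>a k. cell_count (L @ [Z]) a k = cell_count L' a k\<close>[of "Z' ! k" k] by (simp add: snoc)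
    qed
    ultimately have Z: "Z = Z'" by (rule idx_ge_antisym)
    have "L = K"
    proof (rule snoc.IH)
      show "cell_count L a k = cell_count K a k" for a k
        using \<open>\<And>a k. cell_count (L @ [Z]) a k = cell_count L' a k\<close>[of a k] by (simp add: snoc Z)
    qed (use snoc.prems snoc in \<open>auto simp: sorted_wrt_append\<close>)
    then show ?thesis by (simp add: snoc Z)
  qed
qed

section \<open>The standard monomials are linearly independent\<close>

fun left_row :: "hindex \<Rightarrow> nat list list" where
  "left_row (HP A B) = [A]" | "left_row (HU I) = [I]" | "left_row (HXi J) = []"

fun right_row :: "hindex \<Rightarrow> nat list list" where
  "right_row (HP A B) = [B]" | "right_row (HU I) = []" | "right_row (HXi J) = [J]"

abbreviation left_tableau :: "hindex list \<Rightarrow> nat list list" where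
  "left_tableau hs \<equiv> concat (map left_row hs)"

abbreviation right_tableau :: "hindex list \<Rightarrow> nat list list" where
  "right_tableau hs \<equiv> concat (map right_row hs)"

lemma tableaux_sorted:
  assumes "sorted_wrt H_ge hs"
  shows "sorted_wrt idx_ge (left_tableau hs)" "sorted_wrt idx_ge (right_tableau hs)"
proof -
  have l: "idx_ge A A'" if "H_ge h h'" "A \<in> set (left_row h)" "A' \<in> set (left_row h')" for h h' A A'
    using that by (cases h; cases h') auto
  have r: "idx_ge A A'" if "H_ge h h'" "A \<in> set (right_row h)" "A' \<in> set (right_row h')" for h h' A A'
    using that by (cases h; cases h') auto
  have "sorted_wrt idx_ge (left_row h)" "sorted_wrt idx_ge (right_row h)" for h by (cases h; simp)+
  then show "sorted_wrt idx_ge (left_tableau hs)" "sorted_wrt idx_ge (right_tableau hs)"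
    using assms l r by (induction hs) (auto simp: sorted_wrt_append)
qed

text \<open>
  The factors \<open>p(A, B)\<close> contribute to both tableaux, and only one of the two tableaux can be
  longer than their number. So the lengths of the tableaux tell how many factors \<open>p\<close>, \<open>u\<close> and
  \<open>\<xi>\<close> there are.
\<close>

lemma standard_seqs_determined:
  assumes "hs \<in> standard_seqs n m q" "hs' \<in> standard_seqs n m q"
    "left_tableau hs = left_tableau hs'" "right_tableau hs = right_tableau hs'"
  shows "hs = hs'"
proof -
  have form: "\<exists>ps Is Js. hs = map (case_prod HP) ps @ map HU Is @ map HXi Js \<and> (Is = [] \<or> Js = [])"
    if "hs \<in> standard_seqs n m q" for hs
    using that unfolding standard_seqs_def by (force intro: exI[of _ "[]"])
  have tab: "left_tableau (map (case_prod HP) ps @ map HU Is @ map HXi Js) = map fst ps @ Is"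
    "right_tableau (map (case_prod HP) ps @ map HU Is @ map HXi Js) = map snd ps @ Js" for ps Is Js
  proof -
    have "left_tableau (map (case_prod HP) ps) = map fst ps" "right_tableau (map (case_prod HP) ps) = map snd ps"
      by (induction ps) auto
    moreover have "left_tableau (map HU Is) = Is" "right_tableau (map HU Is) = []" by (induction Is) auto
    moreover have "left_tableau (map HXi Js) = []" "right_tableau (map HXi Js) = Js" by (induction Js) auto
    ultimately show "left_tableau (map (case_prod HP) ps @ map HU Is @ map HXi Js) = map fst ps @ Is"
      "right_tableau (map (case_prod HP) ps @ map HU Is @ map HXi Js) = map snd ps @ Js" by auto
  qed
  obtain ps Is Js where hs: "hs = map (case_prod HP) ps @ map HU Is @ map HXi Js" "Is = [] \<or> Js = []"
    using form[OF assms(1)] by blast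
  obtain ps' Is' Js' where hs': "hs' = map (case_prod HP) ps' @ map HU Is' @ map HXi Js'" "Is' = [] \<or> Js' = []"
    using form[OF assms(2)] by blast
  have L: "map fst ps @ Is = map fst ps' @ Is'" and R: "map snd ps @ Js = map snd ps' @ Js'"
    using assms(3,4) unfolding hs(1) hs'(1) tab by auto
  have "length ps + length Is = length ps' + length Is'" "length ps + length Js = length ps' + length Js'"
    using arg_cong[OF L, of length] arg_cong[OF R, of length] by simp_all
  then have len: "length ps = length ps'" using hs(2) hs'(2) by auto
  then have "map fst ps = map fst ps'" "map snd ps = map snd ps'" "Is = Is'" "Js = Js'" using L R by auto
  moreover from this have "ps = ps'" by (metis zip_map_fst_snd)
  ultimately show ?thesis unfolding hs hs' by simp
qed

definition row_cells :: "nat \<Rightarrow> nat \<Rightarrow> nat \<Rightarrow> nat list \<Rightarrow> nat multiset" where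
  "row_cells N n s A = image_mset (\<lambda>i. cell_code N n s (A ! i) i) (mset_set {0..<length A})"

text \<open>
  The codes of the coordinates in the leading term.
\<close>

definition seq_cells :: "nat \<Rightarrow> nat \<Rightarrow> hindex list \<Rightarrow> nat multiset" where
  "seq_cells N n hs = (\<Sum>A\<leftarrow>left_tableau hs. row_cells N n 0 A) + (\<Sum>B\<leftarrow>right_tableau hs. row_cells N n 1 B)"

lemma row_degree_cells: "row_degree M N n s A = (\<Sum>c\<in>#row_cells N n s A. M ^ c)"
  by (simp add: row_degree_def row_cells_def sum_unfold_sum_mset image_mset.compositionality o_def)

lemma count_row_cells:
  assumes "set A \<subseteq> {..<N}" "length A \<le> n" "a < N" "k < n"
  shows "count (row_cells N n s' A) (cell_code N n s a k) = (if s = s' \<and> k < length A \<and> A ! k = a then 1 else 0)"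
proof -
  have "A ! i < N" if "i < length A" for i using assms(1) that nth_mem[of i A] by blast
  then have "(\<lambda>i. cell_code N n s' (A ! i) i) -` {cell_code N n s a k} \<inter> {0..<length A} =
      (if s = s' \<and> k < length A \<and> A ! k = a then {k} else {})"
    using assms by (auto dest!: cell_code_inj)
  then show ?thesis unfolding row_cells_def by (simp add: count_image_mset)
qed

lemma count_seq_cells:
  assumes "\<forall>A\<in>set (left_tableau hs) \<union> set (right_tableau hs). set A \<subseteq> {..<N} \<and> length A \<le> n" "a < N" "k < n"
  shows "count (seq_cells N n hs) (cell_code N n 0 a k) = cell_count (left_tableau hs) a k"
    "count (seq_cells N n hs) (cell_code N n 1 a k) = cell_count (right_tableau hs) a k"
proof -
  have *: "count (\<Sum>A\<leftarrow>L. row_cells N n s' A) (cell_code N n s a k) = (if s = s' then cell_count L a k else 0)"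
    if "\<forall>A\<in>set L. set A \<subseteq> {..<N} \<and> length A \<le> n" for L s s'
    using that by (induction L) (auto simp: cell_count_def count_row_cells[OF _ _ assms(2,3)])
  show "count (seq_cells N n hs) (cell_code N n 0 a k) = cell_count (left_tableau hs) a k"
    "count (seq_cells N n hs) (cell_code N n 1 a k) = cell_count (right_tableau hs) a k"
    using assms(1) unfolding seq_cells_def by (subst count_union, subst (1 2) *; auto)+
qed

lemma tableau_rows:
  assumes "set hs \<subseteq> H_set n m q" "A \<in> set (left_tableau hs) \<union> set (right_tableau hs)" "n \<ge> 1"
  shows "set A \<subseteq> {..<m + q}" "length A \<le> n" "A \<noteq> []"
proof -
  obtain h where h: "h \<in> H_set n m q" "A \<in> set (left_row h) \<union> set (right_row h)" using assms by auto
  have "set A \<subseteq> {..<m + q} \<and> length A \<le> n \<and> A \<noteq> []"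
    using h(1)
  proof (cases rule: H_set_cases)
    case (HP B C)
    then show ?thesis using h(2) by (fastforce simp: pair_idx_def mem_idx_iff)
  next
    case (HU I)
    then show ?thesis using h(2) assms(3) by (fastforce simp: mem_idx_iff)
  next
    case (HXi J)
    then show ?thesis using h(2) assms(3) by (fastforce simp: mem_idx_iff)
  qed
  then show "set A \<subseteq> {..<m + q}" "length A \<le> n" "A \<noteq> []" by auto
qed

lemma seq_cells_inj:
  assumes "n \<ge> 1" "hs \<in> standard_seqs n m q" "hs' \<in> standard_seqs n m q"
    "seq_cells (m + q) n hs = seq_cells (m + q) n hs'"
  shows "hs = hs'"
proof (rule standard_seqs_determined[OF assms(2,3)])
  have sub: "set hs \<subseteq> H_set n m q" "set hs' \<subseteq> H_set n m q"
    and sorted: "sorted_wrt H_ge hs" "sorted_wrt H_ge hs'"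
    using assms by (auto simp: standard_seqs_def)
  have rows: "set A \<subseteq> {..<m + q} \<and> length A \<le> n \<and> A \<noteq> []"
    if "A \<in> set (left_tableau hs) \<union> set (right_tableau hs) \<union> (set (left_tableau hs') \<union> set (right_tableau hs'))" for A
    using that tableau_rows[OF sub(1) _ assms(1)] tableau_rows[OF sub(2) _ assms(1)] by blast
  have zero: "cell_count L a k = 0" if "\<forall>A\<in>set L. set A \<subseteq> {..<m + q} \<and> length A \<le> n" "\<not> (a < m + q \<and> k < n)" for L a k
  proof -
    have "\<not> (k < length A \<and> A ! k = a)" if "A \<in> set L" for A
      using that \<open>\<forall>A\<in>set L. _\<close> \<open>\<not> (a < m + q \<and> k < n)\<close> nth_mem[of k A] by fastforce
    then show ?thesis by (simp add: cell_count_def filter_empty_conv)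
  qed
  have c: "cell_count (left_tableau hs) a k = cell_count (left_tableau hs') a k \<and>
      cell_count (right_tableau hs) a k = cell_count (right_tableau hs') a k" for a k
  proof (cases "a < m + q \<and> k < n")
    case True
    have "\<forall>A\<in>set (left_tableau hs) \<union> set (right_tableau hs). set A \<subseteq> {..<m + q} \<and> length A \<le> n"
      "\<forall>A\<in>set (left_tableau hs') \<union> set (right_tableau hs'). set A \<subseteq> {..<m + q} \<and> length A \<le> n"
      using rows by blast+
    from count_seq_cells[OF this(1), of a k] count_seq_cells[OF this(2), of a k] True
    show ?thesis using assms(4) by simp
  next
    case False
    have "cell_count L a k = 0" if "L \<in> {left_tableau hs, right_tableau hs, left_tableau hs', right_tableau hs'}" for L
      by (rule zero[OF _ False]) (use rows that in blast)
    then show ?thesis by simp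
  qed
  have ne: "[] \<notin> set (left_tableau hs) \<union> set (right_tableau hs) \<union> (set (left_tableau hs') \<union> set (right_tableau hs'))"
    using rows by blast
  show "left_tableau hs = left_tableau hs'"
    by (rule tableau_determined) (use c ne tableaux_sorted[OF sorted(1)] tableaux_sorted[OF sorted(2)] in auto)
  show "right_tableau hs = right_tableau hs'"
    by (rule tableau_determined) (use c ne tableaux_sorted[OF sorted(1)] tableaux_sorted[OF sorted(2)] in auto)
qed

lemma monic_deg_generator:
  assumes h: "h \<in> H_set n m q" and M: "n < M"
  shows "monic_deg (generator_value n (cell_monom M (m + q) n 0) (cell_monom M (m + q) n 1) h :: 'k::field poly)
    (\<Sum>c\<in>#seq_cells (m + q) n [h]. M ^ c)"
  using h
proof (cases rule: H_set_cases)
  case (HP A B)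
  then obtain r where "length A = r" "length B = r" "r \<le> n" "sorted_wrt (<) A" "sorted_wrt (<) B"
    "set A \<subseteq> {..<m + q}" "set B \<subseteq> {..<m + q}"
    by (force simp: pair_idx_def mem_idx_iff)
  then show ?thesis
    using monic_deg_pairing_minor[of A "m + q" r B n M 0 1] M
    by (simp add: HP generator_value_def seq_cells_def row_degree_cells)
next
  case (HU I)
  then have "length I = n" "sorted_wrt (<) I" "set I \<subseteq> {..<m + q}" by (auto simp: mem_idx_iff)
  then show ?thesis
    using monic_deg_maximal_minor[of I "m + q" n M 0] M
    by (simp add: HU generator_value_def seq_cells_def row_degree_cells)
next
  case (HXi J)
  then have "length J = n" "sorted_wrt (<) J" "set J \<subseteq> {..<m + q}" by (force simp: mem_idx_iff)+
  then show ?thesis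
    using monic_deg_maximal_minor[of J "m + q" n M 1] M
    by (simp add: HXi generator_value_def seq_cells_def row_degree_cells)
qed

lemma monic_deg_monomial:
  assumes "set hs \<subseteq> H_set n m q" and M: "n < M"
  shows "monic_deg (\<Prod>h\<leftarrow>hs. generator_value n (cell_monom M (m + q) n 0) (cell_monom M (m + q) n 1) h :: 'k::field poly)
    (\<Sum>c\<in>#seq_cells (m + q) n hs. M ^ c)"
  using assms(1)
proof (induction hs)
  case Nil
  then show ?case by (simp add: seq_cells_def monic_deg_1)
next
  case (Cons h hs)
  have "seq_cells (m + q) n (h # hs) = seq_cells (m + q) n [h] + seq_cells (m + q) n hs"
    by (simp add: seq_cells_def)
  then show ?case
    using monic_deg_mult[OF monic_deg_generator[of h n m q M] Cons.IH] Cons.prems M by simp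
qed

lemma poly_bracket:
  assumes "length B = length A"
  shows "poly (bracket g A B) t = bracket (\<lambda>a b. poly (g a b) t) A B"
  unfolding bracket_leibniz[OF assms]
  by (auto simp: poly_sum poly_prod sign_def intro!: sum.cong)

lemma poly_generator_value:
  assumes "h \<in> H_set n m q"
  shows "poly (generator_value n u w h) t = generator_value n (\<lambda>i k. poly (u i k) t) (\<lambda>j k. poly (w j k) t) h"
  using assms
  by (cases rule: H_set_cases) (auto simp: generator_value_def poly_bracket poly_sum pair_idx_def mem_idx_iff)

lemma alg_closed_infinite: "infinite (UNIV :: 'k::alg_closed_field set)"
proof
  assume fin: "finite (UNIV :: 'k set)"
  define P :: "'k poly" where "P = (\<Prod>a\<in>UNIV. [:- a, 1:])"
  have P0: "poly P x = 0" for x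
    unfolding P_def poly_prod using fin by (intro prod_zero) auto
  have "degree P = card (UNIV :: 'k set)"
    unfolding P_def by (subst degree_prod_eq_sum_degree) auto
  then have "degree P > 0" using fin by (simp add: card_gt_0_iff)
  then have "degree (P + 1) > 0"
    by (metis add.commute degree_1 degree_add_eq_right)
  then obtain x where "poly (P + 1) x = 0"
    using alg_closed_imp_poly_has_root by blast
  then show False using P0 by simp
qed

lemma standard_monomials_independent:
  fixes c :: "hindex list \<Rightarrow> 'k::alg_closed_field"
  assumes n: "n \<ge> 1" and T: "finite T" "T \<subseteq> standard_seqs n m q"
    and zero: "(\<Sum>hs\<in>T. fscale (c hs) (monomial_fun n m q hs)) = 0" and hs0: "hs0 \<in> T"
  shows "c hs0 = 0"
proof (rule ccontr)
  assume c0: "c hs0 \<noteq> 0"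
  \<comment> \<open>\<open>M\<close> exceeds \<open>n\<close>, as needed for leading terms, and the number of cells of each monomial, so that degrees determine contents.\<close>
  define M where "M = Suc (n + (\<Sum>hs\<in>T. size (seq_cells (m + q) n hs)))"
  define P :: "hindex list \<Rightarrow> 'k poly" where
    "P hs = (\<Prod>h\<leftarrow>hs. generator_value n (cell_monom M (m + q) n 0) (cell_monom M (m + q) n 1) h)" for hs
  define D where "D hs = (\<Sum>c\<in>#seq_cells (m + q) n hs. M ^ c)" for hs
  have sub: "set hs \<subseteq> H_set n m q" if "hs \<in> T" for hs
    using T(2) that by (auto simp: standard_seqs_def)
  have deg: "monic_deg (P hs) (D hs)" if "hs \<in> T" for hs
    unfolding P_def D_def by (rule monic_deg_monomial[OF sub[OF that]]) (simp add: M_def)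
  have inj: "hs = hs'" if "hs \<in> T" "hs' \<in> T" "D hs = D hs'" for hs hs'
  proof -
    have small: "size (seq_cells (m + q) n hs) < M" if "hs \<in> T" for hs
      using member_le_sum[of hs T "\<lambda>hs. size (seq_cells (m + q) n hs)"] that T(1) by (simp add: M_def)
    have "seq_cells (m + q) n hs = seq_cells (m + q) n hs'"
      using that small by (intro power_sum_inj[of M]) (auto simp: D_def)
    then show ?thesis using that T(2) n by (intro seq_cells_inj[of n hs m q hs']) auto
  qed
  have "poly (\<Sum>hs\<in>T. smult (c hs) (P hs)) t = 0" for t
  proof -
    \<comment> \<open>The point of \<open>X\<close> on the curve with parameter \<open>t\<close>.\<close>
    define x :: "'k mat \<times> 'k mat" where
      "x = (mat m n (\<lambda>(i, k). poly (cell_monom M (m + q) n 0 i k) t),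
            mat n q (\<lambda>(k, j). poly (cell_monom M (m + q) n 1 j k) t))"
    have xX: "x \<in> X_space n m q" by (simp add: x_def X_space_def)
    have "monomial_fun n m q hs x = poly (P hs) t" if "hs \<in> T" for hs
    proof -
      have "generator_value n (coord_u x) (coord_w x) h =
          poly (generator_value n (cell_monom M (m + q) n 0) (cell_monom M (m + q) n 1) h) t" if "h \<in> set hs" for h
      proof -
        have h: "h \<in> H_set n m q" using sub[OF \<open>hs \<in> T\<close>] that by blast
        show ?thesis unfolding poly_generator_value[OF h] by (rule generator_value_cong[OF h]) (simp_all add: x_def)
      qed
      then have "(\<Prod>h\<leftarrow>hs. generator_value n (coord_u x) (coord_w x) h) = poly (P hs) t"
        unfolding P_def by (induction hs) auto
      then show ?thesis using xX by (simp add: monomial_fun_eq[OF sub[OF that]] fun_on_def)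
    qed
    then have "poly (\<Sum>hs\<in>T. smult (c hs) (P hs)) t = (\<Sum>hs\<in>T. fscale (c hs) (monomial_fun n m q hs)) x"
      by (simp add: poly_sum fscale_def sum_fun_apply)
    then show ?thesis by (simp add: zero)
  qed
  then have "{t. poly (\<Sum>hs\<in>T. smult (c hs) (P hs)) t = 0} = UNIV" by simp
  then have S0: "(\<Sum>hs\<in>T. smult (c hs) (P hs)) = 0"
    using poly_roots_finite alg_closed_infinite by metis
  define T' where "T' = {hs \<in> T. c hs \<noteq> 0}"
  have T': "finite T'" "hs0 \<in> T'" using T(1) hs0 c0 by (auto simp: T'_def)
  have "Max (D ` T') \<in> D ` T'" using T' by (intro Max_in) auto
  then obtain hs1 where "hs1 \<in> T'" "D hs1 = Max (D ` T')" by auto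
  then have hs1: "hs1 \<in> T'" "\<And>hs. hs \<in> T' \<Longrightarrow> D hs \<le> D hs1" using T'(1) by simp_all
  have "coeff (\<Sum>hs\<in>T. smult (c hs) (P hs)) (D hs1) = (\<Sum>hs\<in>T. if hs = hs1 then c hs1 else 0)"
    unfolding coeff_sum
  proof (rule sum.cong)
    fix hs assume hs: "hs \<in> T"
    show "coeff (smult (c hs) (P hs)) (D hs1) = (if hs = hs1 then c hs1 else 0)"
    proof (cases "hs = hs1 \<or> c hs = 0")
      case True
      then show ?thesis using deg[OF hs] hs1(1) by (auto simp: monic_deg_def T'_def)
    next
      case False
      then have "D hs \<le> D hs1" "D hs \<noteq> D hs1"
        using hs hs1 inj[of hs hs1] by (auto simp: T'_def)
      then show ?thesis using deg[OF hs] False by (auto simp: monic_deg_def)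
    qed
  qed simp
  also have "\<dots> = c hs1" using hs1(1) T(1) by (simp add: T'_def)
  finally show False using S0 hs1(1) by (simp add: T'_def)
qed

theorem theorem4p5p3:
  fixes n m q :: nat
  assumes "n \<ge> 1" and "m > n" and "q > n"
  shows "family_basis (standard_seqs n m q) (monomial_fun n m q)
    (S_alg n m q :: ('k::alg_closed_field mat \<times> 'k mat \<Rightarrow> 'k) set)"
  unfolding family_basis_def
proof (intro conjI)
  let ?b = "monomial_fun n m q :: hindex list \<Rightarrow> 'k mat \<times> 'k mat \<Rightarrow> 'k"
  let ?I = "standard_seqs n m q"
  note indep = standard_monomials_independent[OF assms(1), where 'k = 'k]
  show inj: "inj_on ?b ?I"
  proof (rule inj_onI, rule ccontr)
    fix hs hs' assume h: "hs \<in> ?I" "hs' \<in> ?I" "?b hs = ?b hs'" "hs \<noteq> hs'"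
    have "(1 :: 'k) = 0"
      using indep[of "{hs, hs'}" m q "\<lambda>h. if h = hs then 1 else -1" hs] h
      by (auto simp: fscale_def fun_eq_iff)
    then show False by simp
  qed
  show "\<not> fun_vs.dependent (?b ` ?I)"
  proof
    assume "fun_vs.dependent (?b ` ?I)"
    then obtain t d where t: "finite t" "t \<subseteq> ?b ` ?I" "(\<Sum>v\<in>t. fscale (d v) v) = 0" "\<exists>v\<in>t. d v \<noteq> 0"
      unfolding fun_vs.dependent_explicit by blast
    obtain T where T: "T \<subseteq> ?I" "finite T" "t = ?b ` T"
      using finite_subset_image[OF t(1,2)] by blast
    have "(\<Sum>hs\<in>T. fscale (d (?b hs)) (?b hs)) = 0"
      using t(3) unfolding T(3) by (subst (asm) sum.reindex) (auto intro: inj_on_subset[OF inj T(1)])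
    then have "d (?b hs) = 0" if "hs \<in> T" for hs
      using indep[OF T(2,1), of "\<lambda>hs. d (?b hs)" hs] that by blast
    then show False using t(4) T(3) by blast
  qed
  show "fun_vs.span (?b ` ?I) = S_alg n m q"
    by (rule standard_span_eq[OF assms(1)])
qed

end
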